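(* Let $\mu,\nu$ be probability measures on $([0,\infty),\mathcal B([0,\infty)))$ with $\int x\,\mu(dx)=\int y\,\nu(dy)=1$ and $\mu\preccurlyeq\nu$ in the convex order, and let $Q\in\mathcal M(\mu,\nu)$. The following two properties are equivalent: (i) $Q$ is an extremal point of $\mathcal M(\mu,\nu)$; (ii) the set of all functions $f\in L^1(Q)$ that can be represented as $$f(x,y)=\varphi(x)+h(x)(y-x)-\psi(y)\quad Q\text{-a.s.}$$ for some $\varphi\in L^1(\mu)$, $\psi\in L^1(\nu)$ and $h\in L^0(\mu)$ is dense in $L^1(Q)$ (for the norm topology).
   Context: $\mathbb R_+=[0,\infty)$. $\mu\preccurlyeq\nu$ in the convex order means $\int c\,d\mu\le\int c\,d\nu$ for all convex $c:\mathbb R_+\to\mathbb R$. $\mathcal M(\mu,\nu)$ is the set of all probability measures $Q$ on $(\mathbb R_+^2,\mathcal B(\mathbb R_+^2))$ with first marginal $\mu$ and second marginal $\nu$ which satisfy the martingale property: writing $Q(dx,dy)=q(x,dy)\mu(dx)$ with $q$ a probability kernel, $\int y\,q(x,dy)=x$ for $\mu$-a.e. $x$. $Q\in\mathcal M(\mu,\nu)$ is extremal if $Q=\alpha Q_1+(1-\alpha)Q_2$ with $\alpha\in(0,1)$ and $Q_1,Q_2\in\mathcal M(\mu,\nu)$ implies $Q=Q_1=Q_2$. $L^0(\mu)$ is the set of measurable functions that are finite $\mu$-a.s. *)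

theory Defs
  imports "HOL-Probability.Probability"
begin

definition half_line :: "real measure" where
  "half_line = restrict_space borel {0..}"

definition quadrant :: "(real \<times> real) measure" where
  "quadrant = restrict_space borel ({0..} \<times> {0..})"

(* The Bochner integral of a non-integrable function is 0 by convention, so it cannot be
   used to compare integrals of convex functions, which may be infinite.
   Under a law with finite first moment, a convex function on [0,oo) has integrable
   negative part (it has an affine minorant), so the difference below is never oo - oo. *)
definition ext_integral :: "'a measure \<Rightarrow> ('a \<Rightarrow> real) \<Rightarrow> ereal" where
  "ext_integral M f =
     enn2ereal (\<integral>\<^sup>+ x. ennreal (f x) \<partial>M) - enn2ereal (\<integral>\<^sup>+ x. ennreal (- f x) \<partial>M)"

definition convex_order :: "real measure \<Rightarrow> real measure \<Rightarrow> bool" where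
  "convex_order \<mu> \<nu> \<longleftrightarrow>
     (\<forall>c :: real \<Rightarrow> real. convex_on {0..} c \<longrightarrow> ext_integral \<mu> c \<le> ext_integral \<nu> c)"

(* Q(dx,dy) = q(x,dy) mu(dx) *)
definition disintegrates ::
    "(real \<times> real) measure \<Rightarrow> real measure \<Rightarrow> (real \<Rightarrow> real measure) \<Rightarrow> bool" where
  "disintegrates Q \<mu> q \<longleftrightarrow>
     q \<in> half_line \<rightarrow>\<^sub>M prob_algebra half_line \<and>
     (\<forall>A \<in> sets quadrant. emeasure Q A = (\<integral>\<^sup>+ x. emeasure (q x) (Pair x -` A) \<partial>\<mu>))"

(* has_bochner_integral, because at x = 0 the equation "integral = x" alone would also be
   satisfied by a q x of infinite mean. *)
definition martingale_measures ::
    "real measure \<Rightarrow> real measure \<Rightarrow> (real \<times> real) measure set" where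
  "martingale_measures \<mu> \<nu> =
     {Q. prob_space Q \<and> sets Q = sets quadrant \<and>
         distr Q half_line fst = \<mu> \<and> distr Q half_line snd = \<nu> \<and>
         (\<exists>q. disintegrates Q \<mu> q \<and> (AE x in \<mu>. has_bochner_integral (q x) (\<lambda>y. y) x))}"

definition extremal_martingale_measure ::
    "real measure \<Rightarrow> real measure \<Rightarrow> (real \<times> real) measure \<Rightarrow> bool" where
  "extremal_martingale_measure \<mu> \<nu> Q \<longleftrightarrow>
     Q \<in> martingale_measures \<mu> \<nu> \<and>
     (\<forall>\<alpha> Q\<^sub>1 Q\<^sub>2. 0 < \<alpha> \<and> \<alpha> < 1 \<and>
        Q\<^sub>1 \<in> martingale_measures \<mu> \<nu> \<and> Q\<^sub>2 \<in> martingale_measures \<mu> \<nu> \<and>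
        (\<forall>A \<in> sets quadrant. measure Q A = \<alpha> * measure Q\<^sub>1 A + (1 - \<alpha>) * measure Q\<^sub>2 A)
        \<longrightarrow> Q = Q\<^sub>1 \<and> Q = Q\<^sub>2)"

definition L0 :: "'a measure \<Rightarrow> ('a \<Rightarrow> ereal) set" where
  "L0 M = {h \<in> borel_measurable M. AE x in M. \<bar>h x\<bar> \<noteq> \<infinity>}"

(* Functions, not classes modulo null sets; the set is closed under a.e. equality
   within the integrable functions. *)
definition semistatic_functions ::
    "real measure \<Rightarrow> real measure \<Rightarrow> (real \<times> real) measure \<Rightarrow> (real \<times> real \<Rightarrow> real) set" where
  "semistatic_functions \<mu> \<nu> Q =
     {f. integrable Q f \<and>
        (\<exists>\<phi> \<psi> h. integrable \<mu> \<phi> \<and> integrable \<nu> \<psi> \<and> h \<in> L0 \<mu> \<and>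
           (AE (x, y) in Q.
              ereal (f (x, y)) = ereal (\<phi> x) + h x * ereal (y - x) - ereal (\<psi> y)))}"

definition dense_in_L1 :: "'a measure \<Rightarrow> ('a \<Rightarrow> real) set \<Rightarrow> bool" where
  "dense_in_L1 M D \<longleftrightarrow>
     D \<subseteq> {f. integrable M f} \<and>
     (\<forall>g. integrable M g \<longrightarrow> (\<forall>\<epsilon>>0. \<exists>f\<in>D. (\<integral>z. \<bar>g z - f z\<bar> \<partial>M) < \<epsilon>))"

end

theory Submission
  imports Defs "HOL-Library.Function_Algebras"
begin

text \<open>
  This is a Douglas type theorem. If the semistatic functions are dense and
  \<open>Q = \<alpha> Q\<^sub>1 + (1 - \<alpha>) Q\<^sub>2\<close>, then \<open>Q\<^sub>1 \<le> Q / \<alpha>\<close>, so density in \<open>L\<^sup>1(Q)\<close> is density for \<open>Q\<^sub>1\<close> as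
  well; since \<open>Q\<close> and \<open>Q\<^sub>1\<close> integrate semistatic functions to the same value, they agree.
  Conversely, if they are not dense, then by Hahn--Banach and the duality of \<open>L\<^sup>1\<close> and \<open>L\<^sup>\<infinity>\<close>
  some nonzero \<open>g\<close> with \<open>\<bar>g\<bar> \<le> 1\<close> annihilates all semistatic functions. The measures
  \<open>(1 + g) Q\<close> and \<open>(1 - g) Q\<close> are then martingale measures with the same marginals, and \<open>Q\<close> is
  their midpoint.
\<close>

text \<open>Two points shape the argument. In a semistatic function the coefficient \<open>h\<close>
  is merely measurable. The term h(x)(y - x) is integrable only as a whole, being almost surely f -
  \<phi>(x) + \<psi>(y). Its integral vanishes because its positive and negative parts agree on
  almost every fibre. The martingale property asks for a kernel, so a measure with a density G
  against Q needs one explicitly. Weighting the old kernel by G(x, .) is already correct for almost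
  every x: total mass 1 follows from testing against 1_A(x), and mean x from testing against y
  1_A(x) = x 1_A(x) + 1_A(x)(y - x). Both functions are semistatic, and so is 1_B(y), which controls
  the second marginal. Orthogonality of g to the semistatic functions therefore keeps the weighted
  measures among the martingale measures, and the bound 1 on g keeps the weights 1 + g and 1 - g
  nonnegative.\<close>

section \<open>The Hahn--Banach theorem\<close>

text \<open>The carrier \<open>V\<close> is a subset of the type, because in the application it
  consists of the integrable functions among all functions. Homogeneity is demanded only for
  positive factors; the value at 0 follows from it.\<close>

locale sublinear_on = vector_space scale
  for scale :: "real \<Rightarrow> 'b::ab_group_add \<Rightarrow> 'b" (infixr \<open>\<odot>\<close> 75) +
  fixes V :: "'b set" and p :: "'b \<Rightarrow> real"
  assumes subspace: "subspace V"
    and subadditive: "\<lbrakk>x \<in> V; y \<in> V\<rbrakk> \<Longrightarrow> p (x + y) \<le> p x + p y"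
    and pos_homogeneous: "\<lbrakk>x \<in> V; 0 < c\<rbrakk> \<Longrightarrow> p (c \<odot> x) = c * p x"
begin

lemma add_mem: "\<lbrakk>x \<in> V; y \<in> V\<rbrakk> \<Longrightarrow> x + y \<in> V"
  and scale_mem: "x \<in> V \<Longrightarrow> c \<odot> x \<in> V"
  and neg_mem: "x \<in> V \<Longrightarrow> - x \<in> V"
  and zero_mem: "0 \<in> V"
  using subspace by (auto intro: subspace_add subspace_scale subspace_neg subspace_0)

lemma zero [simp]: "p 0 = 0"
  using pos_homogeneous[of 0 2] zero_mem by simp

lemma neg_le: "x \<in> V \<Longrightarrow> - p (- x) \<le> p x"
  using subadditive[of x "- x"] neg_mem by simp

text \<open>\<open>tilt a\<close> is a sublinear functional below \<open>p\<close> with \<open>tilt a (- a) \<le> - p a\<close>, so that every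
  linear functional below it takes the value \<open>p a\<close> at \<open>a\<close>.\<close>

definition tilt :: "'b \<Rightarrow> 'b \<Rightarrow> real" where
  "tilt a x = (if x \<in> V then INF t\<in>{0..}. p (x + t \<odot> a) - t * p a else 0)"

text \<open>A real infimum is meaningful only over a set bounded below. The bound comes from writing
  t a as (x + t a) + (- x), and it does not depend on t.\<close>

lemma tilt_bdd_below:
  assumes "a \<in> V" "x \<in> V"
  shows "bdd_below ((\<lambda>t. p (x + t \<odot> a) - t * p a) ` {0..})"
proof (rule bdd_belowI2)
  fix t :: real assume t: "t \<in> {0..}"
  have "p (t \<odot> a) = t * p a"
    using t assms pos_homogeneous[of a t] by (cases "t = 0") auto
  moreover have "p (t \<odot> a) \<le> p (x + t \<odot> a) + p (- x)"
    using subadditive[of "x + t \<odot> a" "- x"] assms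
    by (simp add: add_mem scale_mem neg_mem)
  ultimately show "- p (- x) \<le> p (x + t \<odot> a) - t * p a" by simp
qed

lemma tilt_le:
  assumes "a \<in> V" "x \<in> V" "0 \<le> t"
  shows "tilt a x \<le> p (x + t \<odot> a) - t * p a"
  using assms cINF_lower[OF tilt_bdd_below, of a x t] by (simp add: tilt_def)

lemma tilt_greatest:
  assumes "x \<in> V" "\<And>t. 0 \<le> t \<Longrightarrow> b \<le> p (x + t \<odot> a) - t * p a"
  shows "b \<le> tilt a x"
  using assms by (auto simp: tilt_def intro!: cINF_greatest)

text \<open>Parameters s for x and t for y combine to s + t for x + y, which gives subadditivity
  after two independent infima. Homogeneity holds because c t runs through the half-line together
  with t.\<close>

lemma sublinear_on_tilt:
  assumes a: "a \<in> V"
  shows "sublinear_on scale V (tilt a)"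
proof unfold_locales
  show "subspace V" by (rule subspace)
next
  fix x y assume x: "x \<in> V" and y: "y \<in> V"
  have *: "tilt a (x + y) \<le> (p (x + s \<odot> a) - s * p a) + (p (y + t \<odot> a) - t * p a)"
    if "0 \<le> s" "0 \<le> t" for s t
  proof -
    have "(x + y) + (s + t) \<odot> a = (x + s \<odot> a) + (y + t \<odot> a)"
      by (simp add: scale_left_distrib)
    then have "p ((x + y) + (s + t) \<odot> a) \<le> p (x + s \<odot> a) + p (y + t \<odot> a)"
      using subadditive[of "x + s \<odot> a" "y + t \<odot> a"] x y a
      by (simp only: add_mem scale_mem)
    then show ?thesis
      using tilt_le[OF a add_mem[OF x y], of "s + t"] that by (simp add: algebra_simps)
  qed
  have "tilt a (x + y) - (p (x + s \<odot> a) - s * p a) \<le> tilt a y" if "0 \<le> s" for s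
  proof (rule tilt_greatest[OF y])
    fix t :: real assume "0 \<le> t"
    from *[OF that this]
    show "tilt a (x + y) - (p (x + s \<odot> a) - s * p a) \<le> p (y + t \<odot> a) - t * p a" by linarith
  qed
  then have "tilt a (x + y) - tilt a y \<le> tilt a x"
    using x by (intro tilt_greatest) (auto simp: algebra_simps)
  then show "tilt a (x + y) \<le> tilt a x + tilt a y" by simp
next
  \<comment> \<open>One inequality for all positive c suffices: applied to c x with the factor 1/c
    it yields the reverse one.\<close>
  have le: "tilt a (c \<odot> x) \<le> c * tilt a x" if x: "x \<in> V" and c: "0 < c" for c x
  proof -
    have "tilt a (c \<odot> x) / c \<le> p (x + t \<odot> a) - t * p a" if t: "0 \<le> t" for t
    proof -
      have "c \<odot> x + (c * t) \<odot> a = c \<odot> (x + t \<odot> a)"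
        by (simp add: scale_right_distrib)
      then have "p (c \<odot> x + (c * t) \<odot> a) = c * p (x + t \<odot> a)"
        using pos_homogeneous c x a by (simp add: add_mem scale_mem)
      then have "tilt a (c \<odot> x) \<le> c * (p (x + t \<odot> a) - t * p a)"
        using tilt_le[OF a scale_mem[OF x], of "c * t" c] t c by (simp add: algebra_simps)
      then show ?thesis using c by (simp add: field_simps)
    qed
    then have "tilt a (c \<odot> x) / c \<le> tilt a x" using x by (intro tilt_greatest)
    then show ?thesis using c by (simp add: field_simps)
  qed
  fix x and c :: real assume x: "x \<in> V" and c: "0 < c"
  have "tilt a x \<le> inverse c * tilt a (c \<odot> x)"
    using le[of "c \<odot> x" "inverse c"] x c by (simp add: scale_mem)
  then have "c * tilt a x \<le> tilt a (c \<odot> x)" using c by (simp add: field_simps)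
  with le[OF x c] show "tilt a (c \<odot> x) = c * tilt a x" by simp
qed

lemma tilt_le_self: "\<lbrakk>a \<in> V; x \<in> V\<rbrakk> \<Longrightarrow> tilt a x \<le> p x"
  using tilt_le[of a x 0] by simp

text \<open>Zorn's lemma for the reversed pointwise order. The pointwise infimum of a chain is
  finite, since each member satisfies q x \<ge> - q (- x) \<ge> - p (- x).\<close>

lemma exists_minimal:
  "\<exists>q. sublinear_on scale V q \<and> (\<forall>x\<in>V. q x \<le> p x) \<and>
    (\<forall>r. sublinear_on scale V r \<and> (\<forall>x\<in>V. r x \<le> q x) \<longrightarrow> (\<forall>x\<in>V. r x = q x))"
proof -
  \<comment> \<open>Values off \<open>V\<close> are set to 0, so that order and equality of
    functions on the whole type coincide with order and equality on \<open>V\<close>.\<close>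
  define S where "S = {q. sublinear_on scale V q \<and> (\<forall>x\<in>V. q x \<le> p x) \<and> (\<forall>x. x \<notin> V \<longrightarrow> q x = 0)}"
  let ?z = "\<lambda>q x. if x \<in> V then q x else (0::real)"
  have zero_ext: "sublinear_on scale V (?z q)" if "sublinear_on scale V q" for q
  proof -
    interpret q: sublinear_on "scale" V q by fact
    show ?thesis
      by unfold_locales (auto simp: subspace q.subadditive q.pos_homogeneous add_mem scale_mem)
  qed
  have "\<exists>m\<in>S. \<forall>r\<in>S. m \<ge> r \<longrightarrow> r = m"
  proof (rule predicate_Zorn)
    show "partial_order_on S (relation_of (\<ge>) S)"
      by (rule partial_order_on_relation_ofI) auto
  next
    fix C assume C: "C \<in> Chains (relation_of (\<ge>) S)"
    then have CS: "q \<in> S" if "q \<in> C" for q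
      using that by (auto simp: Chains_def relation_of_def)
    have chain: "q \<le> r \<or> r \<le> q" if "q \<in> C" "r \<in> C" for q r
      using C that by (auto simp: Chains_def relation_of_def)
    show "\<exists>u\<in>S. \<forall>q\<in>C. q \<ge> u"
    proof (cases "C = {}")
      case True
      have "?z p \<in> S" using zero_ext sublinear_on_axioms by (auto simp: S_def)
      with True show ?thesis by auto
    next
      case False
      define u where "u x = (if x \<in> V then INF q\<in>C. q x else 0)" for x
      have bdd: "bdd_below ((\<lambda>q. q x) ` C)" if x: "x \<in> V" for x
      proof (rule bdd_belowI2)
        fix q assume "q \<in> C"
        then have q: "sublinear_on scale V q" "q (- x) \<le> p (- x)"
          using CS x neg_mem by (auto simp: S_def)
        with sublinear_on.neg_le[OF q(1) x] show "- p (- x) \<le> q x" by simp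
      qed
      have lower: "u x \<le> q x" if "q \<in> C" "x \<in> V" for q x
        using cINF_lower[OF bdd that(1)] that by (simp add: u_def)
      have greatest: "b \<le> u x" if "x \<in> V" "\<And>q. q \<in> C \<Longrightarrow> b \<le> q x" for b x
        using that False by (auto simp: u_def intro!: cINF_greatest)
      have "sublinear_on scale V u"
      proof unfold_locales
        show "subspace V" by (rule subspace)
      next
        fix x y assume x: "x \<in> V" and y: "y \<in> V"
        \<comment> \<open>The smaller of \<open>q\<close> and \<open>r\<close> lies below both, so
          its subadditivity gives a bound in which the two infima can be taken separately.\<close>
        have *: "u (x + y) \<le> q x + r y" if q: "q \<in> C" and r: "r \<in> C" for q r
        proof -
          obtain s where s: "s \<in> C" "s \<le> q" "s \<le> r" using chain q r by blast
          then interpret s: sublinear_on "scale" V s using CS by (auto simp: S_def)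
          have "u (x + y) \<le> s (x + y)" using lower[OF s(1)] add_mem x y by simp
          also have "\<dots> \<le> s x + s y" by (rule s.subadditive[OF x y])
          also have "\<dots> \<le> q x + r y" using s by (auto simp: le_fun_def intro: add_mono)
          finally show ?thesis .
        qed
        have "u (x + y) - q x \<le> u y" if "q \<in> C" for q
          using *[OF that] y by (intro greatest) (auto simp: algebra_simps)
        then have "u (x + y) - u y \<le> u x"
          using x by (intro greatest) (auto simp: algebra_simps)
        then show "u (x + y) \<le> u x + u y" by simp
      next
        fix x and c :: real assume x: "x \<in> V" and c: "0 < c"
        have hom: "q (c \<odot> x) = c * q x" if "q \<in> C" for q
          using CS[OF that] x c by (auto simp: S_def sublinear_on.pos_homogeneous)
        have "u (c \<odot> x) / c \<le> u x"
          using lower[OF _ scale_mem[OF x], of _ c] hom c x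
          by (intro greatest) (auto simp: field_simps)
        moreover have "c * u x \<le> u (c \<odot> x)"
        proof (rule greatest[OF scale_mem[OF x]])
          show "c * u x \<le> q (c \<odot> x)" if "q \<in> C" for q
            using lower[OF that x] hom[OF that] c by simp
        qed
        ultimately show "u (c \<odot> x) = c * u x" using c by (simp add: field_simps)
      qed
      moreover have "u x \<le> p x" if x: "x \<in> V" for x
      proof -
        obtain q where "q \<in> C" using False by auto
        with lower[OF this x] CS[OF this] x show ?thesis by (force simp: S_def)
      qed
      ultimately have "u \<in> S" by (auto simp: S_def u_def)
      moreover have "q \<ge> u" if "q \<in> C" for q
        using lower[OF that] CS[OF that] by (auto simp: le_fun_def S_def u_def)
      ultimately show ?thesis by auto
    qed
  qed
  then obtain m where m: "m \<in> S" "\<And>r. r \<in> S \<Longrightarrow> r \<le> m \<Longrightarrow> r = m" by auto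
  have "r x = m x" if r: "sublinear_on scale V r" "\<forall>x\<in>V. r x \<le> m x" and x: "x \<in> V" for r x
  proof -
    have "?z r \<in> S" using zero_ext[OF r(1)] r(2) m(1) by (force simp: S_def)
    moreover have "?z r \<le> m" using r(2) m(1) by (auto simp: S_def le_fun_def)
    ultimately have "?z r = m" by (rule m(2))
    from fun_cong[OF this, of x] x show ?thesis by simp
  qed
  with m(1) show ?thesis by (auto simp: S_def)
qed

text \<open>A minimal sublinear functional is linear, so nothing has to be extended from subspaces.
  Minimality is taken below \<open>tilt a\<close> instead of \<open>p\<close> in order to force the
  value at \<open>a\<close>.\<close>

theorem Hahn_Banach:
  assumes a: "a \<in> V"
  obtains L where "\<And>x y. \<lbrakk>x \<in> V; y \<in> V\<rbrakk> \<Longrightarrow> L (x + y) = L x + L y"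
    and "\<And>c x. x \<in> V \<Longrightarrow> L (c \<odot> x) = c * L x"
    and "\<And>x. x \<in> V \<Longrightarrow> L x \<le> p x" and "L a = p a"
proof -
  interpret t: sublinear_on "scale" V "tilt a" by (rule sublinear_on_tilt[OF a])
  obtain q where q: "sublinear_on scale V q" "\<And>x. x \<in> V \<Longrightarrow> q x \<le> tilt a x"
    and min: "\<And>r x. \<lbrakk>sublinear_on scale V r; \<And>x. x \<in> V \<Longrightarrow> r x \<le> q x; x \<in> V\<rbrakk> \<Longrightarrow> r x = q x"
    using t.exists_minimal by blast
  interpret q: sublinear_on "scale" V q by fact
  \<comment> \<open>Tilting a minimal functional does not change it, which forces superadditivity.\<close>
  have add: "q (x + y) = q x + q y" if x: "x \<in> V" and y: "y \<in> V" for x y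
  proof -
    have "q.tilt y x = q x"
      by (rule min[OF q.sublinear_on_tilt[OF y] q.tilt_le_self[OF y] x])
    with q.tilt_le[OF y x, of 1] q.subadditive[OF x y] show ?thesis by simp
  qed
  have neg: "q (- x) = - q x" if "x \<in> V" for x
    using add[OF that neg_mem[OF that]] by simp
  have scale: "q (c \<odot> x) = c * q x" if x: "x \<in> V" for c x
  proof -
    consider "c = 0" | "c > 0" | "- c > 0" by linarith
    then show ?thesis
    proof cases
      case 3
      have "q (- ((- c) \<odot> x)) = - q ((- c) \<odot> x)" by (intro neg scale_mem x)
      also have "\<dots> = - ((- c) * q x)" using q.pos_homogeneous[OF x 3] by simp
      finally show ?thesis by (simp add: scale_minus_left)
    qed (use q.pos_homogeneous[OF x] in auto)
  qed
  have le: "q x \<le> p x" if "x \<in> V" for x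
    using q(2)[OF that] tilt_le_self[OF a that] by simp
  have "q (- a) \<le> - p a"
    using q(2)[OF neg_mem[OF a]] tilt_le[OF a neg_mem[OF a], of 1] by simp
  then have "q a = p a" using neg[OF a] le[OF a] by simp
  with add scale le show ?thesis using that by blast
qed

end

section \<open>Bounded functionals on integrable functions\<close>

text \<open>The values of \<open>L\<close> on indicators determine \<open>g\<close> by the
  Radon-Nikodym theorem, and continuity of \<open>L\<close> in the norm carries the formula over to
  all integrable functions. The bound is one-sided, as Hahn-Banach delivers it; applied to - f as
  well it becomes two-sided.\<close>

lemma L1_functional_representation:
  fixes M :: "'a measure" and L :: "('a \<Rightarrow> real) \<Rightarrow> real"
  assumes "finite_measure M"
    and add: "\<And>f g. \<lbrakk>integrable M f; integrable M g\<rbrakk> \<Longrightarrow> L (\<lambda>x. f x + g x) = L f + L g"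
    and scale: "\<And>c f. integrable M f \<Longrightarrow> L (\<lambda>x. c * f x) = c * L f"
    and bound: "\<And>f. integrable M f \<Longrightarrow> L f \<le> (\<integral>x. \<bar>f x\<bar> \<partial>M)"
  obtains g where "g \<in> borel_measurable M" "\<And>x. \<bar>g x\<bar> \<le> 1"
    "\<And>f. integrable M f \<Longrightarrow> L f = (\<integral>x. f x * g x \<partial>M)"
proof -
  interpret finite_measure M by fact
  have abs_bound: "\<bar>L f\<bar> \<le> (\<integral>x. \<bar>f x\<bar> \<partial>M)" if "integrable M f" for f
    using bound[OF that] bound[of "\<lambda>x. - 1 * f x"] scale[OF that, of "-1"] that by auto
  have diff: "L (\<lambda>x. f x - g x) = L f - L g" if "integrable M f" "integrable M g" for f g
    using add[OF that(1), of "\<lambda>x. - 1 * g x"] scale[OF that(2), of "-1"] that by auto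
  have ind [simp]: "integrable M (indicat_real A)" if "A \<in> sets M" for A
    using that by (auto simp: less_top[symmetric])
  \<comment> \<open>Adding \<open>M\<close> makes the signed measure \<open>A \<mapsto> L (indicator A)\<close> nonnegative.\<close>
  define F where "F A = measure M A + L (indicat_real A)" for A
  have L_ind: "\<bar>L (indicat_real A)\<bar> \<le> measure M A" if "A \<in> sets M" for A
    using abs_bound[OF ind[OF that]] that by simp
  have F_nonneg: "0 \<le> F A" and F_le: "F A \<le> 2 * measure M A" if "A \<in> sets M" for A
    using L_ind[OF that] by (auto simp: F_def)
  have F_empty: "F {} = 0"
    using L_ind[of "{}"] by (simp add: F_def)
  define N where "N = measure_of (space M) (sets M) (\<lambda>A. ennreal (F A))"
  \<comment> \<open>For a finite additive set function it is enough to have continuity along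
    sequences decreasing to the empty set; here F A \<le> 2 M(A) provides it.\<close>
  have "countably_additive (sets M) (\<lambda>A. ennreal (F A))"
  proof (rule sets.empty_continuous_imp_countably_additive)
    show "positive (sets M) (\<lambda>A. ennreal (F A))" by (simp add: positive_def F_empty)
    show "additive (sets M) (\<lambda>A. ennreal (F A))"
    proof (unfold Measure_Space.additive_def, intro ballI impI)
      fix A B assume AB: "A \<in> sets M" "B \<in> sets M" "A \<inter> B = {}"
      have "indicat_real (A \<union> B) = (\<lambda>x. indicator A x + indicator B x)"
        using AB by (auto simp: fun_eq_iff indicator_def)
      then have "F (A \<union> B) = F A + F B"
        using AB add[OF ind ind] by (simp add: F_def finite_measure_Union)
      then show "ennreal (F (A \<union> B)) = ennreal (F A) + ennreal (F B)"
        using AB F_nonneg by (simp add: ennreal_plus)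
    qed
    show "\<forall>A\<in>sets M. ennreal (F A) \<noteq> \<infinity>" by simp
    fix A :: "nat \<Rightarrow> 'a set"
    assume A: "range A \<subseteq> sets M" "decseq A" "(\<Inter>i. A i) = {}"
    have "(\<lambda>i. measure M (A i)) \<longlonglongrightarrow> 0"
      using finite_Lim_measure_decseq[OF A(1,2)] A(3) by simp
    then have "(\<lambda>i. 2 * measure M (A i)) \<longlonglongrightarrow> 0"
      using tendsto_mult_left[of _ 0 _ 2] by simp
    then have "(\<lambda>i. F (A i)) \<longlonglongrightarrow> 0"
      using A(1) F_nonneg F_le
      by (intro tendsto_sandwich[of "\<lambda>_. 0" "\<lambda>i. F (A i)" sequentially "\<lambda>i. 2 * measure M (A i)" 0])
         (auto intro!: always_eventually)
    then show "(\<lambda>i. ennreal (F (A i))) \<longlonglongrightarrow> 0"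
      using tendsto_ennrealI by fastforce
  qed
  then have N: "emeasure N A = ennreal (F A)" if "A \<in> sets M" for A
    unfolding N_def using that
    by (intro emeasure_measure_of_sigma) (auto simp: positive_def F_empty sets.sigma_algebra_axioms)
  have sets_N [simp]: "sets N = sets M" by (simp add: N_def)
  have "absolutely_continuous M N"
  proof (unfold absolutely_continuous_def, rule subsetI)
    fix A assume A: "A \<in> null_sets M"
    then have "F A = 0"
      using F_nonneg[of A] F_le[of A] by (auto simp: measure_eq_0_null_sets null_setsD2 dest: null_setsD2)
    with A show "A \<in> null_sets N" by (auto simp: N null_sets_def)
  qed
  from Radon_Nikodym[OF this sets_N] obtain G where
    G [measurable]: "G \<in> borel_measurable M" and dens: "density M G = N" by auto
  have G_set: "(\<integral>\<^sup>+x. G x * indicator A x \<partial>M) = ennreal (F A)" if "A \<in> sets M" for A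
    using emeasure_density[OF G that] N[OF that] dens by simp
  have "(\<integral>\<^sup>+x. G x \<partial>M) = ennreal (F (space M))"
    using G_set[OF sets.top] by (simp cong: nn_integral_cong)
  then have "AE x in M. G x \<noteq> \<infinity>"
    by (intro nn_integral_PInf_AE) auto
  define R where "R x = enn2real (G x)" for x
  have R [measurable]: "R \<in> borel_measurable M" unfolding R_def by measurable
  have GR: "AE x in M. G x = ennreal (R x)"
    using \<open>AE x in M. G x \<noteq> \<infinity>\<close> by eventually_elim (auto simp: R_def less_top)
  have R_set: "has_bochner_integral M (\<lambda>x. indicator A x * R x) (F A)" if A: "A \<in> sets M" for A
  proof (rule has_bochner_integral_nn_integral)
    have "(\<integral>\<^sup>+x. ennreal (indicator A x * R x) \<partial>M) = (\<integral>\<^sup>+x. G x * indicator A x \<partial>M)"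
      using GR by (intro nn_integral_cong_AE, eventually_elim) (auto simp: indicator_def)
    then show "(\<integral>\<^sup>+x. ennreal (indicator A x * R x) \<partial>M) = ennreal (F A)"
      by (simp add: G_set A)
  qed (use A F_nonneg in \<open>auto simp: R_def\<close>)
  have int_R [simp]: "integrable M R"
  proof -
    have "integrable M R \<longleftrightarrow> integrable M (\<lambda>x. indicator (space M) x * R x)"
      by (intro Bochner_Integration.integrable_cong) auto
    then show ?thesis using R_set[OF sets.top] by (simp add: has_bochner_integral_iff)
  qed
  have "AE x in M. 0 \<le> 2 - R x"
  proof (rule density_nonneg)
    fix A assume A: "A \<in> sets M"
    have "set_lebesgue_integral M A (\<lambda>x. 2 - R x)
        = (\<integral>x. 2 * indicator A x - indicator A x * R x \<partial>M)"
      by (auto simp: set_lebesgue_integral_def algebra_simps)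
    also have "\<dots> = 2 * measure M A - F A"
      using R_set[OF A] A by (simp add: has_bochner_integral_iff)
    finally show "0 \<le> set_lebesgue_integral M A (\<lambda>x. 2 - R x)"
      using F_le[OF A] by simp
  qed simp
  \<comment> \<open>Almost everywhere 0 \<le> R \<le> 2, so \<open>min\<close> changes R - 1 only on
    a null set. It makes the bound on \<open>g\<close> valid at every point; the lower bound -1 is
    automatic because \<open>enn2real\<close> is nonnegative.\<close>
  moreover define g where "g x = min 1 (R x - 1)" for x
  ultimately have gR: "AE x in M. g x = R x - 1"
    by (auto elim: eventually_mono)
  have g [measurable]: "g \<in> borel_measurable M" unfolding g_def by measurable
  have g_abs: "\<bar>g x\<bar> \<le> 1" for x by (simp add: g_def R_def abs_le_iff)
  have int_mult: "integrable M (\<lambda>x. f x * g x)" if "integrable M f" for f :: "'a \<Rightarrow> real"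
  proof (rule Bochner_Integration.integrable_bound[OF that])
    show "AE x in M. norm (f x * g x) \<le> norm (f x)"
      using g_abs by (auto simp: abs_mult intro!: AE_I2 mult_left_le)
  qed (use that in simp)
  have "L f = (\<integral>x. f x * g x \<partial>M)" if "integrable M f" for f
    using that
  proof (induct f)
    case (base A c)
    have "(\<integral>x. indicator A x * g x \<partial>M) = (\<integral>x. indicator A x * R x - indicator A x \<partial>M)"
      using gR base by (intro integral_cong_AE) (auto elim!: eventually_mono simp: indicator_def)
    also have "\<dots> = F A - measure M A"
      using R_set[OF base(1)] base(1) by (simp add: has_bochner_integral_iff)
    finally have "(\<integral>x. indicator A x * g x \<partial>M) = L (indicat_real A)" by (simp add: F_def)
    moreover have "L (\<lambda>x. indicator A x * c) = c * L (indicat_real A)"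
      using scale[OF ind[OF base(1)], of c] by (simp add: mult.commute)
    moreover have "(\<integral>x. indicator A x * c * g x \<partial>M) = c * (\<integral>x. indicator A x * g x \<partial>M)"
      by (subst integral_mult_right_zero[symmetric]) (simp add: ac_simps)
    ultimately show ?case by simp
  next
    case (add f h)
    then show ?case
      using assms(2)[of f h] int_mult by (simp add: distrib_right)
  next
    case (lim f s)
    have "(\<lambda>i. \<integral>x. \<bar>s i x - f x\<bar> \<partial>M) \<longlonglongrightarrow> (\<integral>x. 0 \<partial>M)"
    \<comment> \<open>The approximating functions satisfy \<bar>s i x\<bar> \<le> 2 \<bar>f x\<bar>,
      which explains the factor 3.\<close>
    proof (rule integral_dominated_convergence[where w="\<lambda>x. 3 * \<bar>f x\<bar>"])
      show "AE x in M. (\<lambda>i. \<bar>s i x - f x\<bar>) \<longlonglongrightarrow> 0"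
        using lim(3) by (auto intro!: AE_I2 tendsto_rabs_zero simp: LIM_zero_iff)
      show "AE x in M. norm \<bar>s i x - f x\<bar> \<le> 3 * \<bar>f x\<bar>" for i
      proof (rule AE_I2)
        fix x assume "x \<in> space M"
        from lim(4)[OF this, of i] show "norm \<bar>s i x - f x\<bar> \<le> 3 * \<bar>f x\<bar>" by simp
      qed
    qed (use lim in auto)
    then have conv: "(\<lambda>i. \<integral>x. \<bar>s i x - f x\<bar> \<partial>M) \<longlonglongrightarrow> 0" by simp
    have "(\<lambda>i. L (s i)) \<longlonglongrightarrow> L f"
    proof (rule LIM_zero_cancel, rule Lim_null_comparison[OF _ conv])
      show "\<forall>\<^sub>F i in sequentially. norm (L (s i) - L f) \<le> (\<integral>x. \<bar>s i x - f x\<bar> \<partial>M)"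
        using abs_bound[OF Bochner_Integration.integrable_diff[OF lim(1,5)]] diff[OF lim(1,5)]
        by (intro always_eventually allI) simp
    qed
    moreover have "(\<lambda>i. L (s i)) \<longlonglongrightarrow> (\<integral>x. f x * g x \<partial>M)"
    proof (rule LIM_zero_cancel, rule Lim_null_comparison[OF _ conv])
      have "\<bar>L (s i) - (\<integral>x. f x * g x \<partial>M)\<bar> \<le> (\<integral>x. \<bar>s i x - f x\<bar> \<partial>M)" for i
      proof -
        have int: "integrable M (\<lambda>x. s i x - f x)" using lim by auto
        have "L (s i) - (\<integral>x. f x * g x \<partial>M) = (\<integral>x. (s i x - f x) * g x \<partial>M)"
          using lim int_mult by (simp add: left_diff_distrib)
        also have "\<bar>\<dots>\<bar> \<le> (\<integral>x. \<bar>(s i x - f x) * g x\<bar> \<partial>M)" by simp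
        also have "\<dots> \<le> (\<integral>x. \<bar>s i x - f x\<bar> \<partial>M)"
          using g_abs by (intro integral_mono integrable_abs int int_mult)
            (auto simp: abs_mult intro!: mult_left_le)
        finally show ?thesis .
      qed
      then show "\<forall>\<^sub>F i in sequentially. norm (L (s i) - (\<integral>x. f x * g x \<partial>M))
          \<le> (\<integral>x. \<bar>s i x - f x\<bar> \<partial>M)"
        by simp
    qed
    ultimately show ?case by (rule LIMSEQ_unique)
  qed
  with g g_abs show ?thesis using that by blast
qed

section \<open>Martingale measures\<close>

text \<open>The identity is measurable in both directions. The product form is the one in which
  kernels, sections and iterated integrals are handled.\<close>

lemma sets_quadrant: "sets quadrant = sets (half_line \<Otimes>\<^sub>M half_line)"
proof (rule antisym)
  have hl: "(\<lambda>x. x) \<in> half_line \<rightarrow>\<^sub>M borel"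
    by (simp add: half_line_def measurable_restrict_space1)
  have "(\<lambda>z. (fst z, snd z)) \<in> half_line \<Otimes>\<^sub>M half_line \<rightarrow>\<^sub>M borel"
    unfolding borel_prod[symmetric]
    by (intro measurable_Pair measurable_compose[OF measurable_fst hl]
          measurable_compose[OF measurable_snd hl])
  then have id: "(\<lambda>z. z) \<in> half_line \<Otimes>\<^sub>M half_line \<rightarrow>\<^sub>M quadrant"
    unfolding quadrant_def
    by (intro measurable_restrict_space2) (auto simp: half_line_def space_pair_measure)
  have sp: "space (half_line \<Otimes>\<^sub>M half_line) = space quadrant"
    by (simp add: half_line_def quadrant_def space_pair_measure space_restrict_space borel_prod[symmetric])
  show "sets quadrant \<subseteq> sets (half_line \<Otimes>\<^sub>M half_line)"
    using measurable_sets[OF id] sets.sets_into_space[of _ quadrant] sp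
    by (auto simp: Int_absorb2)
  have "fst \<in> quadrant \<rightarrow>\<^sub>M half_line" "snd \<in> quadrant \<rightarrow>\<^sub>M half_line"
    unfolding half_line_def quadrant_def
    by (auto intro!: measurable_restrict_space3 simp: borel_prod[symmetric])
  then have id': "(\<lambda>z. z) \<in> quadrant \<rightarrow>\<^sub>M half_line \<Otimes>\<^sub>M half_line"
    by (simp add: measurable_pair_iff comp_def)
  show "sets (half_line \<Otimes>\<^sub>M half_line) \<subseteq> sets quadrant"
    using measurable_sets[OF id'] sets.sets_into_space[of _ "half_line \<Otimes>\<^sub>M half_line"] sp
    by (auto simp: Int_absorb2)
qed

lemma space_half_line [simp]: "space half_line = {0..}"
  by (simp add: half_line_def space_restrict_space)

lemma borel_measurable_half_line: "(\<lambda>x. x) \<in> half_line \<rightarrow>\<^sub>M borel"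
  by (simp add: half_line_def measurable_restrict_space1)

text \<open>\<open>?K x\<close> is the law of (x, y) with y drawn from \<open>q x\<close>. The
  disintegration says that Q is the mixture of these laws over \<mu>, so the integral formula for
  \<open>bind\<close> applies.\<close>

lemma disintegrates_nn_integral:
  assumes dis: "disintegrates Q \<mu> q"
    and Q: "sets Q = sets quadrant" and \<mu>: "sets \<mu> = sets half_line"
    and f: "f \<in> borel_measurable (half_line \<Otimes>\<^sub>M half_line)"
  shows "(\<integral>\<^sup>+z. f z \<partial>Q) = (\<integral>\<^sup>+x. (\<integral>\<^sup>+y. f (x, y) \<partial>q x) \<partial>\<mu>)"
proof -
  let ?P = "half_line \<Otimes>\<^sub>M half_line"
  let ?K = "\<lambda>x. distr (q x) ?P (Pair x)"
  have space: "space \<mu> = {0..}" using sets_eq_imp_space_eq[OF \<mu>] by simp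
  have q: "q \<in> half_line \<rightarrow>\<^sub>M subprob_algebra half_line"
    using dis by (auto simp: disintegrates_def intro: measurable_prob_algebraD)
  have "?K \<in> half_line \<rightarrow>\<^sub>M subprob_algebra ?P"
    by (rule measurable_distr2[OF _ q]) simp
  then have K: "?K \<in> \<mu> \<rightarrow>\<^sub>M subprob_algebra ?P"
    by (simp cong: measurable_cong_sets add: \<mu>)
  have Pair: "Pair x \<in> q x \<rightarrow>\<^sub>M ?P" if "x \<in> space \<mu>" for x
  proof -
    have "sets (q x) = sets half_line"
      using subprob_measurableD(2)[OF q] that space by simp
    then show ?thesis
      using that space by (simp cong: measurable_cong_sets add: measurable_Pair1')
  qed
  have "Q = \<mu> \<bind> ?K"
  proof (rule measure_eqI)
    show "sets Q = sets (\<mu> \<bind> ?K)"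
      using sets_bind[of \<mu> ?K ?P] space Q sets_quadrant by simp
    fix A assume "A \<in> sets Q"
    then have A: "A \<in> sets ?P" using Q sets_quadrant by simp
    have "emeasure (\<mu> \<bind> ?K) A = (\<integral>\<^sup>+x. emeasure (?K x) A \<partial>\<mu>)"
      using space by (intro emeasure_bind[OF _ K A]) auto
    also have "\<dots> = (\<integral>\<^sup>+x. emeasure (q x) (Pair x -` A) \<partial>\<mu>)"
    proof (rule nn_integral_cong)
      fix x assume x: "x \<in> space \<mu>"
      have sp: "space (q x) = {0..}"
        using subprob_measurableD(1)[OF q] x space by simp
      have "Pair x -` A \<inter> space (q x) = Pair x -` A"
        using sets.sets_into_space[OF A] by (auto simp: sp space_pair_measure)
      then show "emeasure (?K x) A = emeasure (q x) (Pair x -` A)"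
        using emeasure_distr[OF Pair[OF x] A] by simp
    qed
    finally show "emeasure Q A = emeasure (\<mu> \<bind> ?K) A"
      using dis A sets_quadrant by (simp add: disintegrates_def)
  qed
  then have "(\<integral>\<^sup>+z. f z \<partial>Q) = (\<integral>\<^sup>+x. (\<integral>\<^sup>+z. f z \<partial>?K x) \<partial>\<mu>)"
    by (simp add: nn_integral_bind[OF f K])
  also have "\<dots> = (\<integral>\<^sup>+x. (\<integral>\<^sup>+y. f (x, y) \<partial>q x) \<partial>\<mu>)"
    using f by (intro nn_integral_cong nn_integral_distr[OF Pair]) simp_all
  finally show ?thesis .
qed

text \<open>A locale over Q, so that its results can be used for a second measure with the same
  marginals, as in \<open>dense_imp_unique\<close>.\<close>

locale martingale_measure =
  fixes \<mu> \<nu> :: "real measure" and Q :: "(real \<times> real) measure"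
  assumes Q: "Q \<in> martingale_measures \<mu> \<nu>"
    and integrable_\<mu>: "integrable \<mu> (\<lambda>x. x)" and integrable_\<nu>: "integrable \<nu> (\<lambda>y. y)"
begin

sublocale prob_space Q using Q by (simp add: martingale_measures_def)

lemma distr_fst: "distr Q half_line fst = \<mu>"
  and distr_snd: "distr Q half_line snd = \<nu>"
  and sets_Q: "sets Q = sets quadrant"
  using Q by (auto simp: martingale_measures_def)

lemma sets_\<mu> [measurable_cong]: "sets \<mu> = sets half_line"
  and sets_\<nu> [measurable_cong]: "sets \<nu> = sets half_line"
  using distr_fst distr_snd by auto

lemma sets_Q' [measurable_cong]: "sets Q = sets (half_line \<Otimes>\<^sub>M half_line)"
  by (simp add: sets_Q sets_quadrant)

lemma space_\<mu>: "space \<mu> = {0..}"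
  and space_Q: "space Q = {0..} \<times> {0..}"
  using sets_eq_imp_space_eq[OF sets_\<mu>] sets_eq_imp_space_eq[OF sets_Q']
    by (auto simp: space_pair_measure)

lemma fst_measurable [measurable]: "fst \<in> Q \<rightarrow>\<^sub>M half_line"
  and snd_measurable [measurable]: "snd \<in> Q \<rightarrow>\<^sub>M half_line"
  by measurable

lemma fst_measurable_\<mu> [measurable]: "fst \<in> Q \<rightarrow>\<^sub>M \<mu>"
  and snd_measurable_\<nu> [measurable]: "snd \<in> Q \<rightarrow>\<^sub>M \<nu>"
  by measurable

lemma borel_measurable_fst [measurable]: "(\<lambda>z. fst z) \<in> borel_measurable Q"
  and borel_measurable_snd [measurable]: "(\<lambda>z. snd z) \<in> borel_measurable Q"
  by (auto intro: measurable_compose[OF _ borel_measurable_half_line])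

text \<open>With the marginals themselves as targets, integrands measurable for \<mu> or \<nu> can
  be pulled back directly.\<close>

lemma \<mu>_eq: "\<mu> = distr Q \<mu> fst" and \<nu>_eq: "\<nu> = distr Q \<nu> snd"
  using distr_fst distr_snd distr_cong[OF refl sets_\<mu>, of Q fst fst]
    distr_cong[OF refl sets_\<nu>, of Q snd snd] by auto

lemma prob_space_\<mu>: "prob_space \<mu>" and prob_space_\<nu>: "prob_space \<nu>"
  using prob_space_distr[OF fst_measurable] prob_space_distr[OF snd_measurable]
  by (simp_all add: distr_fst distr_snd)

lemma AE_fst: "AE x in \<mu>. P x \<Longrightarrow> AE z in Q. P (fst z)"
  by (rule AE_distrD[OF fst_measurable_\<mu>, unfolded \<mu>_eq[symmetric]])

lemma
  fixes \<phi> :: "real \<Rightarrow> real"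
  assumes "integrable \<mu> \<phi>"
  shows integrable_fst: "integrable Q (\<lambda>z. \<phi> (fst z))"
    and integral_fst: "(\<integral>z. \<phi> (fst z) \<partial>Q) = (\<integral>x. \<phi> x \<partial>\<mu>)"
proof -
  have \<phi>: "\<phi> \<in> borel_measurable \<mu>" using assms by auto
  show "integrable Q (\<lambda>z. \<phi> (fst z))"
    using integrable_distr_eq[OF fst_measurable_\<mu> \<phi>] assms by (simp flip: \<mu>_eq)
  show "(\<integral>z. \<phi> (fst z) \<partial>Q) = (\<integral>x. \<phi> x \<partial>\<mu>)"
    using integral_distr[OF fst_measurable_\<mu> \<phi>] by (simp flip: \<mu>_eq)
qed

lemma
  fixes \<psi> :: "real \<Rightarrow> real"
  assumes "integrable \<nu> \<psi>"
  shows integrable_snd: "integrable Q (\<lambda>z. \<psi> (snd z))"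
    and integral_snd: "(\<integral>z. \<psi> (snd z) \<partial>Q) = (\<integral>y. \<psi> y \<partial>\<nu>)"
proof -
  have \<psi>: "\<psi> \<in> borel_measurable \<nu>" using assms by auto
  show "integrable Q (\<lambda>z. \<psi> (snd z))"
    using integrable_distr_eq[OF snd_measurable_\<nu> \<psi>] assms by (simp flip: \<nu>_eq)
  show "(\<integral>z. \<psi> (snd z) \<partial>Q) = (\<integral>y. \<psi> y \<partial>\<nu>)"
    using integral_distr[OF snd_measurable_\<nu> \<psi>] by (simp flip: \<nu>_eq)
qed

lemma kernel:
  obtains q where "disintegrates Q \<mu> q" "AE x in \<mu>. has_bochner_integral (q x) (\<lambda>y. y) x"
    "q \<in> half_line \<rightarrow>\<^sub>M prob_algebra half_line"
  using Q by (auto simp: martingale_measures_def disintegrates_def)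

text \<open>No integrability is assumed: otherwise the Bochner integral is 0 by convention.\<close>

lemma integral_increment_zero:
  assumes h [measurable]: "h \<in> borel_measurable \<mu>"
  shows "(\<integral>z. h (fst z) * (snd z - fst z) \<partial>Q) = 0"
proof -
  obtain q where q: "disintegrates Q \<mu> q" "AE x in \<mu>. has_bochner_integral (q x) (\<lambda>y. y) x"
      "q \<in> half_line \<rightarrow>\<^sub>M prob_algebra half_line"
    by (rule kernel)
  let ?F = "\<lambda>z. h (fst z) * (snd z - fst z)"
  have F [measurable]: "?F \<in> borel_measurable Q" by measurable
  then have F': "?F \<in> borel_measurable (half_line \<Otimes>\<^sub>M half_line)"
    by (simp cong: measurable_cong_sets add: sets_Q')
  \<comment> \<open>On a fibre h(x) is a constant, so the increment is integrable with mean 0 and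
    its two parts have equal finite integrals. Stated for nonnegative integrals, the equality passes
    to Q even if both sides become infinite there.\<close>
  have "AE x in \<mu>. (\<integral>\<^sup>+y. ennreal (?F (x, y)) \<partial>q x) = (\<integral>\<^sup>+y. ennreal (- ?F (x, y)) \<partial>q x)"
    using q(2) AE_space
  proof eventually_elim
    case (elim x)
    then have "prob_space (q x)"
      using measurable_space[OF q(3)] by (auto simp: space_\<mu> space_prob_algebra)
    then interpret q: prob_space "q x" .
    have int: "integrable (q x) (\<lambda>y. ?F (x, y))" and zero: "(\<integral>y. ?F (x, y) \<partial>q x) = 0"
      using elim by (simp_all add: has_bochner_integral_iff q.prob_space)
    have fin: "(\<integral>\<^sup>+y. ennreal (?F (x, y)) \<partial>q x) < \<infinity>" "(\<integral>\<^sup>+y. ennreal (- ?F (x, y)) \<partial>q x) < \<infinity>"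
      using int real_integrable_def[of "q x" "\<lambda>y. ?F (x, y)"] by (auto simp: less_top)
    have "enn2real (\<integral>\<^sup>+y. ennreal (?F (x, y)) \<partial>q x) = enn2real (\<integral>\<^sup>+y. ennreal (- ?F (x, y)) \<partial>q x)"
      using zero unfolding real_lebesgue_integral_def[OF int] by linarith
    then show ?case using fin by (metis ennreal_enn2real infinity_ennreal_def)
  qed
  then have "(\<integral>\<^sup>+z. ennreal (?F z) \<partial>Q) = (\<integral>\<^sup>+z. ennreal (- ?F z) \<partial>Q)"
    using F' by (subst (1 2) disintegrates_nn_integral[OF q(1) sets_Q sets_\<mu>])
      (auto intro!: nn_integral_cong_AE)
  then show ?thesis
    by (cases "integrable Q ?F") (simp_all add: real_lebesgue_integral_def not_integrable_integral_eq)
qed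

text \<open>An extended-real \<open>h\<close> may be replaced by its real part: this changes values
  only on a \<mu>-null set, whose preimage under \<open>fst\<close> is Q-null.\<close>

lemma semistatic_functions_iff:
  "f \<in> semistatic_functions \<mu> \<nu> Q \<longleftrightarrow> integrable Q f \<and>
    (\<exists>\<phi> \<psi> h. integrable \<mu> \<phi> \<and> integrable \<nu> \<psi> \<and> h \<in> borel_measurable \<mu> \<and>
      (AE z in Q. f z = \<phi> (fst z) + h (fst z) * (snd z - fst z) - \<psi> (snd z)))"
  (is "?lhs \<longleftrightarrow> ?rhs")
proof
  assume ?lhs
  then obtain \<phi> \<psi> h where f: "integrable Q f" "integrable \<mu> \<phi>" "integrable \<nu> \<psi>" "h \<in> L0 \<mu>"
    and eq: "AE z in Q. ereal (f z) =
      ereal (\<phi> (fst z)) + h (fst z) * ereal (snd z - fst z) - ereal (\<psi> (snd z))"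
    by (auto simp: semistatic_functions_def split_beta)
  have "AE z in Q. \<bar>h (fst z)\<bar> \<noteq> \<infinity>"
    using f(4) by (intro AE_fst) (simp add: L0_def)
  with eq have "AE z in Q. f z =
      \<phi> (fst z) + real_of_ereal (h (fst z)) * (snd z - fst z) - \<psi> (snd z)"
  proof eventually_elim
    case (elim z)
    then obtain r where "h (fst z) = ereal r" by (cases "h (fst z)") auto
    with elim show ?case by simp
  qed
  moreover have "(\<lambda>x. real_of_ereal (h x)) \<in> borel_measurable \<mu>"
    using f(4) by (auto simp: L0_def intro: borel_measurable_real_of_ereal)
  ultimately show ?rhs using f by blast
next
  assume ?rhs
  then obtain \<phi> \<psi> h where f: "integrable Q f" "integrable \<mu> \<phi>" "integrable \<nu> \<psi>"
      "h \<in> borel_measurable \<mu>"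
    and eq: "AE z in Q. f z = \<phi> (fst z) + h (fst z) * (snd z - fst z) - \<psi> (snd z)" by blast
  have "(\<lambda>x. ereal (h x)) \<in> L0 \<mu>" using f(4) by (simp add: L0_def)
  moreover have "AE (x, y) in Q. ereal (f (x, y)) =
      ereal (\<phi> x) + ereal (h x) * ereal (y - x) - ereal (\<psi> y)"
    using eq by eventually_elim auto
  ultimately show ?lhs using f(1-3) unfolding semistatic_functions_def by blast
qed

text \<open>The value depends on the marginals alone, so martingale measures with the same marginals
  cannot be told apart by semistatic functions. Linearity is used only for f, \<phi> and \<psi>; the
  increment stays in one piece.\<close>

lemma semistatic_integral:
  assumes f: "integrable Q f" and \<phi>: "integrable \<mu> \<phi>" and \<psi>: "integrable \<nu> \<psi>"
    and h [measurable]: "h \<in> borel_measurable \<mu>"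
    and eq: "AE z in Q. f z = \<phi> (fst z) + h (fst z) * (snd z - fst z) - \<psi> (snd z)"
  shows "(\<integral>z. f z \<partial>Q) = (\<integral>x. \<phi> x \<partial>\<mu>) - (\<integral>y. \<psi> y \<partial>\<nu>)"
proof -
  note int = f integrable_fst[OF \<phi>] integrable_snd[OF \<psi>]
  have "(\<integral>z. f z - \<phi> (fst z) + \<psi> (snd z) \<partial>Q) = (\<integral>z. h (fst z) * (snd z - fst z) \<partial>Q)"
  proof (rule integral_cong_AE)
    show "AE z in Q. f z - \<phi> (fst z) + \<psi> (snd z) = h (fst z) * (snd z - fst z)"
      using eq by eventually_elim simp
  qed (use int in measurable)
  then show ?thesis
    using int by (simp add: integral_increment_zero[OF h] integral_fst[OF \<phi>] integral_snd[OF \<psi>])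
qed

text \<open>Disintegrating the three tests shows that the fibre mass \<open>m x\<close> and fibre
  mean \<open>b x\<close> of G(x, .) against \<open>q x\<close> have the same integrals over every
  set as 1 and x. Uniqueness of densities makes them equal almost everywhere, so G(x, .) turns
  \<open>q x\<close> into the kernel of the new measure.\<close>

lemma density_martingale_measure:
  fixes G :: "real \<times> real \<Rightarrow> ennreal"
  assumes G [measurable]: "G \<in> borel_measurable Q"
    and fst: "\<And>A. A \<in> sets \<mu> \<Longrightarrow> (\<integral>\<^sup>+z. G z * indicator A (fst z) \<partial>Q) = emeasure \<mu> A"
    and snd: "\<And>A. A \<in> sets \<nu> \<Longrightarrow> (\<integral>\<^sup>+z. G z * indicator A (snd z) \<partial>Q) = emeasure \<nu> A"
    and mart: "\<And>A. A \<in> sets \<mu> \<Longrightarrow>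
      (\<integral>\<^sup>+z. G z * ennreal (snd z) * indicator A (fst z) \<partial>Q) = (\<integral>\<^sup>+x. ennreal x * indicator A x \<partial>\<mu>)"
  shows "density Q G \<in> martingale_measures \<mu> \<nu>"
proof -
  interpret \<mu>: prob_space \<mu> by (rule prob_space_\<mu>)
  obtain q where q: "disintegrates Q \<mu> q" "q \<in> half_line \<rightarrow>\<^sub>M prob_algebra half_line"
    by (rule kernel)
  have q' [measurable]: "q \<in> half_line \<rightarrow>\<^sub>M subprob_algebra half_line"
    by (rule measurable_prob_algebraD[OF q(2)])
  have q_prob: "prob_space (q x)" and q_sets: "sets (q x) = sets half_line"
    if "x \<in> {0..}" for x
    using measurable_space[OF q(2)] that subprob_measurableD[OF q']
    by (auto simp: space_prob_algebra)
  note disint = disintegrates_nn_integral[OF q(1) sets_Q sets_\<mu>]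
  have G' [measurable]: "G \<in> borel_measurable (half_line \<Otimes>\<^sub>M half_line)"
    using G by (simp cong: measurable_cong_sets add: sets_Q')
  have G_x [measurable]: "(\<lambda>y. G (x, y)) \<in> borel_measurable (q x)" if "x \<in> {0..}" for x
    using measurable_compose[OF measurable_Pair1' G', of x] that
    by (simp cong: measurable_cong_sets add: q_sets)
  have id [measurable]: "(\<lambda>x. x) \<in> half_line \<rightarrow>\<^sub>M borel" by (rule borel_measurable_half_line)
  define m where "m x = (\<integral>\<^sup>+y. G (x, y) \<partial>q x)" for x
  have m [measurable]: "m \<in> borel_measurable half_line"
    unfolding m_def by (rule nn_integral_measurable_subprob_algebra2[OF _ q']) simp
  have m': "m \<in> borel_measurable \<mu>" by measurable
  define b where "b x = (\<integral>\<^sup>+y. G (x, y) * ennreal y \<partial>q x)" for x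
  have "b \<in> borel_measurable half_line"
    unfolding b_def by (rule nn_integral_measurable_subprob_algebra2[OF _ q']) measurable
  then have b: "b \<in> borel_measurable \<mu>" by measurable
  have AE_m: "AE x in \<mu>. m x = 1"
  proof (rule \<mu>.density_unique[OF m'])
    show "density \<mu> m = density \<mu> (\<lambda>_. 1)"
    proof (rule measure_eqI)
      fix A assume "A \<in> sets (density \<mu> m)"
      then have A [measurable]: "A \<in> sets half_line" and A': "A \<in> sets \<mu>" by (auto simp: sets_\<mu>)
      have "emeasure (density \<mu> m) A = (\<integral>\<^sup>+x. m x * indicator A x \<partial>\<mu>)"
        by (rule emeasure_density[OF m' A'])
      also have "\<dots> = (\<integral>\<^sup>+z. G z * indicator A (fst z) \<partial>Q)"
      proof (subst disint)
        show "(\<integral>\<^sup>+x. m x * indicator A x \<partial>\<mu>) =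
            (\<integral>\<^sup>+x. (\<integral>\<^sup>+y. G (x, y) * indicator A (fst (x, y)) \<partial>q x) \<partial>\<mu>)"
          by (intro nn_integral_cong) (auto simp: m_def space_\<mu> indicator_def)
      qed measurable
      finally show "emeasure (density \<mu> m) A = emeasure (density \<mu> (\<lambda>_. 1)) A"
        using fst[OF A'] by (simp add: density_1)
    qed simp
  qed simp
  have AE_b: "AE x in \<mu>. b x = ennreal x"
  proof (rule \<mu>.density_unique[OF b])
    show "(\<lambda>x. ennreal x) \<in> borel_measurable \<mu>" by measurable
    then show "density \<mu> b = density \<mu> (\<lambda>x. ennreal x)"
    proof (intro measure_eqI)
      fix A assume "A \<in> sets (density \<mu> b)"
      then have A [measurable]: "A \<in> sets half_line" and A': "A \<in> sets \<mu>" by (auto simp: sets_\<mu>)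
      have "emeasure (density \<mu> b) A = (\<integral>\<^sup>+x. b x * indicator A x \<partial>\<mu>)"
        by (rule emeasure_density[OF b A'])
      also have "\<dots> = (\<integral>\<^sup>+z. G z * ennreal (snd z) * indicator A (fst z) \<partial>Q)"
      proof (subst disint)
        show "(\<integral>\<^sup>+x. b x * indicator A x \<partial>\<mu>) =
            (\<integral>\<^sup>+x. (\<integral>\<^sup>+y. G (x, y) * ennreal (snd (x, y)) * indicator A (fst (x, y)) \<partial>q x) \<partial>\<mu>)"
          by (intro nn_integral_cong) (auto simp: b_def space_\<mu> indicator_def)
      qed measurable
      finally show "emeasure (density \<mu> b) A = emeasure (density \<mu> (\<lambda>x. ennreal x)) A"
        using mart[OF A'] A' by (simp add: emeasure_density)
    qed simp
  qed
  \<comment> \<open>Off the null set where the conditional mass is not 1, the old kernel is kept so that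
    every value is a probability measure.\<close>
  define k where "k x = (if m x = 1 then density (q x) (\<lambda>y. G (x, y)) else q x)" for x
  have k_sets: "sets (k x) = sets half_line" if "x \<in> {0..}" for x
    using q_sets[OF that] by (simp add: k_def)
  have k_prob: "prob_space (k x)" if x: "x \<in> {0..}" for x
  proof (cases "m x = 1")
    case True
    then have "emeasure (density (q x) (\<lambda>y. G (x, y))) (space (q x)) = 1"
      using G_x[OF x] by (simp add: emeasure_density m_def cong: nn_integral_cong)
    then show ?thesis using True by (intro prob_spaceI) (simp add: k_def)
  qed (use q_prob[OF x] in \<open>simp add: k_def\<close>)
  have k: "k \<in> half_line \<rightarrow>\<^sub>M prob_algebra half_line"
  proof (rule measurable_prob_algebraI)
    show "k \<in> half_line \<rightarrow>\<^sub>M subprob_algebra half_line"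
    proof (rule measurable_subprob_algebra)
      fix A :: "real set" assume A [measurable]: "A \<in> sets half_line"
      have "(\<lambda>x. if m x = 1 then \<integral>\<^sup>+y. G (x, y) * indicator A y \<partial>q x else emeasure (q x) A)
          \<in> borel_measurable half_line"
      proof (rule measurable_If)
        show "(\<lambda>x. \<integral>\<^sup>+y. G (x, y) * indicator A y \<partial>q x) \<in> borel_measurable half_line"
          by (rule nn_integral_measurable_subprob_algebra2[OF _ q']) measurable
      qed measurable
      moreover have "emeasure (k x) A =
          (if m x = 1 then \<integral>\<^sup>+y. G (x, y) * indicator A y \<partial>q x else emeasure (q x) A)"
        if "x \<in> space half_line" for x
        using that by (auto simp: k_def emeasure_density G_x q_sets A)
      ultimately show "(\<lambda>x. emeasure (k x) A) \<in> borel_measurable half_line"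
        by (rule measurable_cong[THEN iffD2, rotated])
    qed (use k_prob k_sets in \<open>auto intro: prob_space_imp_subprob_space\<close>)
  qed (use k_prob in auto)
  have dis: "disintegrates (density Q G) \<mu> k"
    unfolding disintegrates_def
  proof (intro conjI ballI k)
    fix A assume "A \<in> sets quadrant"
    then have A [measurable]: "A \<in> sets (half_line \<Otimes>\<^sub>M half_line)" and A': "A \<in> sets Q"
      by (auto simp: sets_Q sets_quadrant)
    have "emeasure (density Q G) A = (\<integral>\<^sup>+z. G z * indicator A z \<partial>Q)"
      by (rule emeasure_density[OF G A'])
    also have "\<dots> = (\<integral>\<^sup>+x. (\<integral>\<^sup>+y. G (x, y) * indicator A (x, y) \<partial>q x) \<partial>\<mu>)"
      by (rule disint) measurable
    also have "\<dots> = (\<integral>\<^sup>+x. emeasure (k x) (Pair x -` A) \<partial>\<mu>)"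
    proof (rule nn_integral_cong_AE)
      show "AE x in \<mu>. (\<integral>\<^sup>+y. G (x, y) * indicator A (x, y) \<partial>q x) = emeasure (k x) (Pair x -` A)"
        using AE_m AE_space
      proof eventually_elim
        case (elim x)
        then have x: "x \<in> {0..}" by (simp add: space_\<mu>)
        have "Pair x -` A \<in> sets (q x)" using sets_Pair1[OF A] q_sets[OF x] by simp
        moreover have "indicator A (x, y) = (indicator (Pair x -` A) y :: ennreal)" for y
          by (simp add: indicator_def)
        ultimately show ?case
          using elim(1) G_x[OF x] by (simp add: k_def emeasure_density)
      qed
    qed
    finally show "emeasure (density Q G) A = (\<integral>\<^sup>+x. emeasure (k x) (Pair x -` A) \<partial>\<mu>)" .
  qed
  have "AE x in \<mu>. has_bochner_integral (k x) (\<lambda>y. y) x"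
    using AE_m AE_b AE_space
  proof eventually_elim
    case (elim x)
    then have x: "x \<in> {0..}" by (simp add: space_\<mu>)
    have id_q: "(\<lambda>y. y) \<in> borel_measurable (q x)"
      using id by (simp cong: measurable_cong_sets add: q_sets[OF x])
    show ?case
    \<comment> \<open>Since y is nonnegative, the finite value of the nonnegative integral gives
      integrability together with the mean.\<close>
    proof (rule has_bochner_integral_nn_integral)
      show "(\<lambda>y. y) \<in> borel_measurable (k x)"
        using id by (simp cong: measurable_cong_sets add: k_sets[OF x])
      show "AE y in k x. 0 \<le> y"
        using sets_eq_imp_space_eq[OF k_sets[OF x]] by (intro AE_I2) auto
      show "0 \<le> x" using x by simp
      have "(\<integral>\<^sup>+y. ennreal y \<partial>k x) = b x"
        using elim(1) G_x[OF x] id_q by (simp add: k_def b_def nn_integral_density)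
      with elim(2) show "(\<integral>\<^sup>+y. ennreal y \<partial>k x) = ennreal x" by simp
    qed
  qed
  moreover have "distr (density Q G) half_line fst = \<mu>"
  proof (rule measure_eqI)
    fix A assume "A \<in> sets (distr (density Q G) half_line fst)"
    then have A [measurable]: "A \<in> sets half_line" by simp
    have "emeasure (distr (density Q G) half_line fst) A
        = emeasure (density Q G) (fst -` A \<inter> space Q)"
      by (subst emeasure_distr) auto
    also have "\<dots> = (\<integral>\<^sup>+z. G z * indicator A (fst z) \<partial>Q)"
      by (subst emeasure_density) (auto intro!: nn_integral_cong simp: indicator_def)
    finally show "emeasure (distr (density Q G) half_line fst) A = emeasure \<mu> A"
      using fst A by (simp add: sets_\<mu>)
  qed (simp add: sets_\<mu>)
  moreover have "distr (density Q G) half_line snd = \<nu>"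
  proof (rule measure_eqI)
    fix A assume "A \<in> sets (distr (density Q G) half_line snd)"
    then have A [measurable]: "A \<in> sets half_line" by simp
    have "emeasure (distr (density Q G) half_line snd) A
        = emeasure (density Q G) (snd -` A \<inter> space Q)"
      by (subst emeasure_distr) auto
    also have "\<dots> = (\<integral>\<^sup>+z. G z * indicator A (snd z) \<partial>Q)"
      by (subst emeasure_density) (auto intro!: nn_integral_cong simp: indicator_def)
    finally show "emeasure (distr (density Q G) half_line snd) A = emeasure \<nu> A"
      using snd A by (simp add: sets_\<nu>)
  qed (simp add: sets_\<nu>)
  moreover have "prob_space (density Q G)"
  proof (rule prob_spaceI)
    have "emeasure (density Q G) (space Q) = (\<integral>\<^sup>+z. G z * indicator (space \<mu>) (fst z) \<partial>Q)"
      using measurable_space[OF fst_measurable_\<mu>]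
      by (subst emeasure_density) (auto intro!: nn_integral_cong simp: indicator_def)
    then show "emeasure (density Q G) (space (density Q G)) = 1"
      using fst[OF sets.top] \<mu>.emeasure_space_1 by simp
  qed
  ultimately show ?thesis using dis sets_Q by (auto simp: martingale_measures_def)
qed

section \<open>Semistatic functions and extremality\<close>

abbreviation "semistatic \<equiv> semistatic_functions \<mu> \<nu> Q"

lemma semistatic_integrable: "f \<in> semistatic \<Longrightarrow> integrable Q f"
  by (simp add: semistatic_functions_def)

lemma semistaticI:
  assumes "integrable Q f" "integrable \<mu> \<phi>" "integrable \<nu> \<psi>" "h \<in> borel_measurable \<mu>"
    and "AE z in Q. f z = \<phi> (fst z) + h (fst z) * (snd z - fst z) - \<psi> (snd z)"
  shows "f \<in> semistatic"
  using assms unfolding semistatic_functions_iff by blast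

section \<open>The space of semistatic functions and the test functions in it\<close>

lemma semistatic_add:
  assumes "f \<in> semistatic" "g \<in> semistatic"
  shows "(\<lambda>z. f z + g z) \<in> semistatic"
proof -
  from assms[unfolded semistatic_functions_iff] obtain \<phi> \<psi> h \<phi>' \<psi>' h' where
    f: "integrable Q f" "integrable \<mu> \<phi>" "integrable \<nu> \<psi>" "h \<in> borel_measurable \<mu>"
      "AE z in Q. f z = \<phi> (fst z) + h (fst z) * (snd z - fst z) - \<psi> (snd z)"
    and g: "integrable Q g" "integrable \<mu> \<phi>'" "integrable \<nu> \<psi>'" "h' \<in> borel_measurable \<mu>"
      "AE z in Q. g z = \<phi>' (fst z) + h' (fst z) * (snd z - fst z) - \<psi>' (snd z)"
    by blast
  have "AE z in Q. f z + g z = (\<phi> (fst z) + \<phi>' (fst z))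
      + (h (fst z) + h' (fst z)) * (snd z - fst z) - (\<psi> (snd z) + \<psi>' (snd z))"
    using f(5) g(5) by eventually_elim (simp add: algebra_simps)
  with f g show ?thesis
    by (intro semistaticI[of _ "\<lambda>x. \<phi> x + \<phi>' x" "\<lambda>x. \<psi> x + \<psi>' x" "\<lambda>x. h x + h' x"]) auto
qed

lemma semistatic_scale:
  assumes "f \<in> semistatic"
  shows "(\<lambda>z. c * f z) \<in> semistatic"
proof -
  from assms[unfolded semistatic_functions_iff] obtain \<phi> \<psi> h where
    f: "integrable Q f" "integrable \<mu> \<phi>" "integrable \<nu> \<psi>" "h \<in> borel_measurable \<mu>"
      "AE z in Q. f z = \<phi> (fst z) + h (fst z) * (snd z - fst z) - \<psi> (snd z)"
    by blast
  have "AE z in Q. c * f z = c * \<phi> (fst z) + (c * h (fst z)) * (snd z - fst z) - c * \<psi> (snd z)"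
    using f(5) by eventually_elim (simp only: distrib_left right_diff_distrib mult.assoc)
  with f show ?thesis
    by (intro semistaticI[of _ "\<lambda>x. c * \<phi> x" "\<lambda>x. c * \<psi> x" "\<lambda>x. c * h x"]) auto
qed

lemma semistatic_zero: "(\<lambda>z. 0) \<in> semistatic"
  by (rule semistaticI[of _ "\<lambda>x. 0" "\<lambda>y. 0" "\<lambda>x. 0"]) auto

text \<open>With \<open>indicator_snd_semistatic\<close> and \<open>snd_semistatic\<close> this
  supplies the tests asked for by \<open>density_martingale_measure\<close>.\<close>

lemma indicator_fst_semistatic:
  assumes "A \<in> sets \<mu>"
  shows "(\<lambda>z. indicat_real A (fst z)) \<in> semistatic"
proof -
  interpret \<mu>: prob_space \<mu> by (rule prob_space_\<mu>)
  have "integrable \<mu> (indicat_real A)" using assms by (auto simp: less_top[symmetric])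
  then show ?thesis
    by (intro semistaticI[of _ "indicat_real A" "\<lambda>y. 0" "\<lambda>x. 0"]) (auto intro: integrable_fst)
qed

lemma indicator_snd_semistatic:
  assumes "A \<in> sets \<nu>"
  shows "(\<lambda>z. indicat_real A (snd z)) \<in> semistatic"
proof -
  interpret \<nu>: prob_space \<nu> by (rule prob_space_\<nu>)
  have "integrable \<nu> (indicat_real A)" using assms by (auto simp: less_top[symmetric])
  then show ?thesis
    by (intro semistaticI[of _ "\<lambda>x. 0" "\<lambda>y. - indicat_real A y" "\<lambda>x. 0"]) (auto intro: integrable_snd)
qed

text \<open>Here \<phi>(x) = x 1_A(x) and h = 1_A. This is the test that encodes the martingale
  property, through the increment term.\<close>

lemma
  assumes A: "A \<in> sets \<mu>"
  shows snd_semistatic: "(\<lambda>z. snd z * indicat_real A (fst z)) \<in> semistatic"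
    and nn_integral_snd_indicator:
      "(\<integral>\<^sup>+z. ennreal (snd z * indicat_real A (fst z)) \<partial>Q) = (\<integral>\<^sup>+x. ennreal (x * indicat_real A x) \<partial>\<mu>)"
proof -
  have m: "(\<lambda>z. indicat_real A (fst z)) \<in> borel_measurable Q"
    using A by measurable
  have int: "integrable Q (\<lambda>z. snd z * indicat_real A (fst z))"
    by (rule Bochner_Integration.integrable_bound[OF integrable_snd[OF integrable_\<nu>]])
       (use m in \<open>auto simp: indicator_def\<close>)
  have \<phi>: "integrable \<mu> (\<lambda>x. x * indicat_real A x)"
    using integrable_real_mult_indicator[OF A integrable_\<mu>] .
  have eq: "AE z in Q. snd z * indicat_real A (fst z) =
      fst z * indicat_real A (fst z) + indicat_real A (fst z) * (snd z - fst z) - 0"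
    by (simp add: algebra_simps)
  show "(\<lambda>z. snd z * indicat_real A (fst z)) \<in> semistatic"
    by (rule semistaticI[OF int \<phi> _ _ eq]) (use A in auto)
  have "(\<integral>z. snd z * indicat_real A (fst z) \<partial>Q) = (\<integral>x. x * indicat_real A x \<partial>\<mu>) - (\<integral>y. 0 \<partial>\<nu>)"
    by (rule semistatic_integral[OF int \<phi> _ _ eq]) (use A in auto)
  moreover have "(\<integral>\<^sup>+z. ennreal (snd z * indicat_real A (fst z)) \<partial>Q)
      = ennreal (\<integral>z. snd z * indicat_real A (fst z) \<partial>Q)"
    by (rule nn_integral_eq_integral[OF int]) (auto intro!: AE_I2 simp: space_Q)
  moreover have "(\<integral>\<^sup>+x. ennreal (x * indicat_real A x) \<partial>\<mu>) = ennreal (\<integral>x. x * indicat_real A x \<partial>\<mu>)"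
    by (rule nn_integral_eq_integral[OF \<phi>]) (auto intro!: AE_I2 simp: space_\<mu>)
  ultimately show "(\<integral>\<^sup>+z. ennreal (snd z * indicat_real A (fst z)) \<partial>Q)
      = (\<integral>\<^sup>+x. ennreal (x * indicat_real A x) \<partial>\<mu>)"
    by simp
qed

section \<open>Density implies extremality\<close>

lemma dense_imp_unique:
  assumes dense: "dense_in_L1 Q semistatic" and \<alpha>: "0 < \<alpha>"
    and Q': "Q' \<in> martingale_measures \<mu> \<nu>"
    and le: "\<And>A. A \<in> sets quadrant \<Longrightarrow> \<alpha> * measure Q' A \<le> measure Q A"
  shows "Q' = Q"
proof -
  interpret Q': martingale_measure \<mu> \<nu> Q'
    by unfold_locales (use Q' integrable_\<mu> integrable_\<nu> in auto)
  have sets [simp]: "sets Q' = sets Q" by (simp add: sets_Q Q'.sets_Q)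
  have emeasure_le: "emeasure Q' A \<le> ennreal (1 / \<alpha>) * emeasure Q A" if "A \<in> sets Q" for A
    using le[of A] that \<alpha>
    by (simp add: sets_Q emeasure_eq_measure Q'.emeasure_eq_measure ennreal_mult[symmetric] field_simps)
  then have "Q' \<le> scale_measure (ennreal (1 / \<alpha>)) Q"
    by (simp add: le_measure)
  then have nn_le: "(\<integral>\<^sup>+z. f z \<partial>Q') \<le> ennreal (1 / \<alpha>) * (\<integral>\<^sup>+z. f z \<partial>Q)" if "f \<in> borel_measurable Q" for f
    using nn_integral_mono_measure[of Q' "scale_measure (ennreal (1 / \<alpha>)) Q" f] that
    by (simp add: nn_integral_scale_measure)
  \<comment> \<open>A semistatic representation holds only Q-almost surely; absolute continuity
    makes it hold for \<open>Q'\<close> too.\<close>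
  have ac: "absolutely_continuous Q Q'"
    unfolding absolutely_continuous_def
  proof (rule subsetI)
    show "A \<in> null_sets Q'" if "A \<in> null_sets Q" for A
      using emeasure_le[of A] that by (simp add: null_sets_def)
  qed
  have int: "integrable Q' f" and int_le: "(\<integral>z. \<bar>f z\<bar> \<partial>Q') \<le> 1 / \<alpha> * (\<integral>z. \<bar>f z\<bar> \<partial>Q)"
    if f: "integrable Q f" for f :: "real \<times> real \<Rightarrow> real"
  proof -
    have "f \<in> borel_measurable Q'"
      using f measurable_cong_sets[OF sets refl] by auto
    have bound: "(\<integral>\<^sup>+z. ennreal \<bar>f z\<bar> \<partial>Q') \<le> ennreal (1 / \<alpha> * (\<integral>z. \<bar>f z\<bar> \<partial>Q))"
      using nn_le[of "\<lambda>z. ennreal \<bar>f z\<bar>"] f \<alpha>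
      by (simp add: nn_integral_eq_integral ennreal_mult[symmetric])
    then show "integrable Q' f"
      using \<open>f \<in> borel_measurable Q'\<close> by (auto simp: integrable_iff_bounded le_less_trans)
    then show "(\<integral>z. \<bar>f z\<bar> \<partial>Q') \<le> 1 / \<alpha> * (\<integral>z. \<bar>f z\<bar> \<partial>Q)"
      using bound \<alpha> by (simp add: nn_integral_eq_integral)
  qed
  have same: "(\<integral>z. f z \<partial>Q') = (\<integral>z. f z \<partial>Q)" if fD: "f \<in> semistatic" for f
  proof -
    from fD[unfolded semistatic_functions_iff] obtain \<phi> \<psi> h where
      f: "integrable Q f" "integrable \<mu> \<phi>" "integrable \<nu> \<psi>" "h \<in> borel_measurable \<mu>"
        "AE z in Q. f z = \<phi> (fst z) + h (fst z) * (snd z - fst z) - \<psi> (snd z)"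
      by blast
    from Q'.semistatic_integral[OF int[OF f(1)] f(2-4) absolutely_continuous_AE[OF sets ac f(5)]]
      semistatic_integral[OF f]
    show ?thesis by simp
  qed
  have "measure Q' A = measure Q A" if A: "A \<in> sets Q" for A
  proof -
    \<comment> \<open>The approximation error enters once under Q and once under \<open>Q'\<close>,
      where it is at most 1/\<alpha> times as large.\<close>
    let ?C = "1 / \<alpha> + 1"
    have C: "0 < ?C" using \<alpha> by (simp add: add_pos_pos)
    have indA: "integrable Q (indicat_real A)" using A by (auto simp: less_top[symmetric])
    have "\<bar>measure Q' A - measure Q A\<bar> \<le> 0 + e" if e: "0 < e" for e
    proof -
      have "0 < e / ?C" using e C by simp
      then obtain f where f: "f \<in> semistatic" "(\<integral>z. \<bar>indicat_real A z - f z\<bar> \<partial>Q) < e / ?C"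
        using dense indA unfolding dense_in_L1_def by blast
      have int_f: "integrable Q f" by (rule semistatic_integrable[OF f(1)])
      have int_d: "integrable Q (\<lambda>z. indicat_real A z - f z)" using indA int_f by simp
      have "measure Q' A - measure Q A =
          (\<integral>z. indicat_real A z - f z \<partial>Q') - (\<integral>z. indicat_real A z - f z \<partial>Q)"
        using same[OF f(1)] int[OF int_f] int[OF indA] indA int_f A by simp
      also have "\<bar>\<dots>\<bar> \<le> (\<integral>z. \<bar>indicat_real A z - f z\<bar> \<partial>Q') + (\<integral>z. \<bar>indicat_real A z - f z\<bar> \<partial>Q)"
        by (rule order_trans[OF abs_triangle_ineq4]) (intro add_mono integral_abs_bound)
      also have "\<dots> \<le> ?C * (\<integral>z. \<bar>indicat_real A z - f z\<bar> \<partial>Q)"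
        using int_le[OF int_d] by (simp add: algebra_simps)
      also have "\<dots> \<le> e" using f(2) C by (simp add: field_simps)
      finally show ?thesis by simp
    qed
    then have "\<bar>measure Q' A - measure Q A\<bar> \<le> 0" by (rule field_le_epsilon)
    then show ?thesis by simp
  qed
  then show ?thesis
    by (intro measure_eqI) (auto simp: emeasure_eq_measure Q'.emeasure_eq_measure)
qed

lemma dense_imp_extremal:
  assumes "dense_in_L1 Q semistatic"
  shows "extremal_martingale_measure \<mu> \<nu> Q"
  unfolding extremal_martingale_measure_def
proof (intro conjI Q allI impI; elim conjE)
  fix \<alpha> :: real and Q\<^sub>1 Q\<^sub>2
  assume \<alpha>: "0 < \<alpha>" "\<alpha> < 1"
    and M: "Q\<^sub>1 \<in> martingale_measures \<mu> \<nu>" "Q\<^sub>2 \<in> martingale_measures \<mu> \<nu>"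
    and eq: "\<forall>A\<in>sets quadrant. measure Q A = \<alpha> * measure Q\<^sub>1 A + (1 - \<alpha>) * measure Q\<^sub>2 A"
  show "Q = Q\<^sub>1"
    by (rule dense_imp_unique[OF assms \<alpha>(1) M(1), symmetric]) (use eq \<alpha> in auto)
  show "Q = Q\<^sub>2"
    by (rule dense_imp_unique[OF assms _ M(2), symmetric, of "1 - \<alpha>"]) (use eq \<alpha> in auto)
qed

section \<open>Extremality implies density\<close>

lemma separating_function:
  assumes "\<not> dense_in_L1 Q semistatic"
  obtains g f where "g \<in> borel_measurable Q" "\<And>z. \<bar>g z\<bar> \<le> 1"
    "\<And>d. d \<in> semistatic \<Longrightarrow> (\<integral>z. d z * g z \<partial>Q) = 0"
    "integrable Q f" "(\<integral>z. f z * g z \<partial>Q) \<noteq> 0"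
proof -
  have "semistatic \<subseteq> {f. integrable Q f}" using semistatic_integrable by blast
  with assms obtain a e where a: "integrable Q a" and e: "0 < e"
    and far: "\<And>d. d \<in> semistatic \<Longrightarrow> e \<le> (\<integral>z. \<bar>a z - d z\<bar> \<partial>Q)"
    unfolding dense_in_L1_def by (auto simp: not_less)
  \<comment> \<open>Integrable functions are treated as a subspace \<open>V\<close> of the space of
    all functions with pointwise operations, without passing to classes modulo null sets.\<close>
  define sc :: "real \<Rightarrow> (real \<times> real \<Rightarrow> real) \<Rightarrow> real \<times> real \<Rightarrow> real" where
    "sc c f = (\<lambda>z. c * f z)" for c f
  define V where "V = {f. integrable Q (f :: real \<times> real \<Rightarrow> real)}"
  \<comment> \<open>The distance to the semistatic functions. A linear L below it is at most the
    norm, vanishes on the semistatic functions, and L a = p a \<ge> e > 0 makes it nonzero.\<close>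
  define p where "p f = (INF d\<in>semistatic. \<integral>z. \<bar>f z - d z\<bar> \<partial>Q)" for f
  have bdd: "bdd_below ((\<lambda>d. \<integral>z. \<bar>f z - d z\<bar> \<partial>Q) ` semistatic)" for f
    by (rule bdd_belowI2[of _ 0]) simp
  have p_le: "p f \<le> (\<integral>z. \<bar>f z - d z\<bar> \<partial>Q)" if "d \<in> semistatic" for f d
    unfolding p_def by (rule cINF_lower[OF bdd that])
  have p_ge: "b \<le> p f" if "\<And>d. d \<in> semistatic \<Longrightarrow> b \<le> (\<integral>z. \<bar>f z - d z\<bar> \<partial>Q)" for f b
    unfolding p_def using semistatic_zero that by (intro cINF_greatest) auto
  have hom_le: "p (sc c f) \<le> c * p f" if c: "0 < c" for c f
  proof -
    have "p (sc c f) / c \<le> p f"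
    proof (rule p_ge)
      fix d assume "d \<in> semistatic"
      then have "p (sc c f) \<le> (\<integral>z. \<bar>sc c f z - c * d z\<bar> \<partial>Q)"
        by (intro p_le semistatic_scale)
      also have "\<dots> = (\<integral>z. c * \<bar>f z - d z\<bar> \<partial>Q)"
        using c by (intro Bochner_Integration.integral_cong)
          (simp_all add: sc_def abs_mult flip: right_diff_distrib)
      finally show "p (sc c f) / c \<le> (\<integral>z. \<bar>f z - d z\<bar> \<partial>Q)"
        using c by (simp add: field_simps)
    qed
    then show ?thesis using c by (simp add: field_simps)
  qed
  interpret sc: vector_space sc
    by unfold_locales (auto simp: sc_def fun_eq_iff algebra_simps)
  interpret sublinear_on sc V p
  proof unfold_locales
    show "sc.subspace V"
      by (auto simp: sc.subspace_def V_def sc_def plus_fun_def zero_fun_def)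
  next
    fix f g assume fg: "f \<in> V" "g \<in> V"
    have *: "p (f + g) \<le> (\<integral>z. \<bar>f z - d z\<bar> \<partial>Q) + (\<integral>z. \<bar>g z - d' z\<bar> \<partial>Q)"
      if d: "d \<in> semistatic" "d' \<in> semistatic" for d d'
    proof -
      have int: "integrable Q f" "integrable Q g" "integrable Q d" "integrable Q d'"
        using fg d semistatic_integrable by (auto simp: V_def)
      have "p (f + g) \<le> (\<integral>z. \<bar>(f + g) z - (d z + d' z)\<bar> \<partial>Q)"
        by (intro p_le semistatic_add d)
      also have "\<dots> \<le> (\<integral>z. \<bar>f z - d z\<bar> + \<bar>g z - d' z\<bar> \<partial>Q)"
        using int by (intro integral_mono) auto
      also have "\<dots> = (\<integral>z. \<bar>f z - d z\<bar> \<partial>Q) + (\<integral>z. \<bar>g z - d' z\<bar> \<partial>Q)"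
        using int by simp
      finally show ?thesis .
    qed
    have "p (f + g) - (\<integral>z. \<bar>f z - d z\<bar> \<partial>Q) \<le> p g" if "d \<in> semistatic" for d
      using *[OF that] by (intro p_ge) (simp add: diff_le_eq add.commute)
    then have "p (f + g) - p g \<le> p f"
      by (intro p_ge) (simp add: diff_le_eq add.commute)
    then show "p (f + g) \<le> p f + p g" by simp
  next
    fix f and c :: real assume "f \<in> V" and c: "0 < c"
    have "p f \<le> inverse c * p (sc c f)"
      using hom_le[of "inverse c" "sc c f"] c by (simp add: sc_def mult.assoc[symmetric])
    with hom_le[OF c, of f] c show "p (sc c f) = c * p f" by (simp add: field_simps)
  qed
  obtain L where L_add: "\<And>x y. \<lbrakk>x \<in> V; y \<in> V\<rbrakk> \<Longrightarrow> L (x + y) = L x + L y"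
    and L_scale: "\<And>c x. x \<in> V \<Longrightarrow> L (sc c x) = c * L x"
    and L_le: "\<And>x. x \<in> V \<Longrightarrow> L x \<le> p x" and L_a: "L a = p a"
    using Hahn_Banach[of a] a unfolding V_def by blast
  have L_add': "L (\<lambda>z. f z + h z) = L f + L h" if "integrable Q f" "integrable Q h" for f h
    using L_add[of f h] that by (simp add: V_def plus_fun_def)
  have L_scale': "L (\<lambda>z. c * f z) = c * L f" if "integrable Q f" for c f
    using L_scale[of f c] that by (simp add: V_def sc_def)
  have L_le': "L f \<le> (\<integral>z. \<bar>f z\<bar> \<partial>Q)" if "integrable Q f" for f
    using L_le[of f] p_le[OF semistatic_zero, of f] that by (simp add: V_def)
  obtain g where g: "g \<in> borel_measurable Q" "\<And>z. \<bar>g z\<bar> \<le> 1"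
    and rep: "\<And>f. integrable Q f \<Longrightarrow> L f = (\<integral>z. f z * g z \<partial>Q)"
    using L1_functional_representation[OF finite_measure_axioms L_add' L_scale' L_le'] by blast
  have "(\<integral>z. d z * g z \<partial>Q) = 0" if d: "d \<in> semistatic" for d
  proof -
    \<comment> \<open>The distance of a semistatic function to the space is 0; used for d and for -
      d, the one-sided bound gives L d = 0.\<close>
    have le: "L d \<le> 0" if "d \<in> semistatic" for d
      using L_le[of d] p_le[OF that, of d] semistatic_integrable[OF that] by (simp add: V_def)
    have "L (\<lambda>z. - 1 * d z) = - L d"
      using L_scale'[OF semistatic_integrable[OF d], of "-1"] by simp
    with le[OF d] le[OF semistatic_scale[OF d, of "-1"]] have "L d = 0" by simp
    with rep[OF semistatic_integrable[OF d]] show ?thesis by simp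
  qed
  moreover have "(\<integral>z. a z * g z \<partial>Q) \<noteq> 0"
    using rep[OF a] L_a p_ge[OF far] e by auto
  ultimately show ?thesis using that g a by blast
qed

text \<open>All tests of \<open>density_martingale_measure\<close> integrate nonnegative semistatic
  functions, and the weight 1 + g does not change such integrals.\<close>

lemma perturbation:
  assumes g [measurable]: "g \<in> borel_measurable Q" and g_le: "\<And>z. \<bar>g z\<bar> \<le> 1"
    and ortho: "\<And>d. d \<in> semistatic \<Longrightarrow> (\<integral>z. d z * g z \<partial>Q) = 0"
  shows "density Q (\<lambda>z. ennreal (1 + g z)) \<in> martingale_measures \<mu> \<nu>"
proof (rule density_martingale_measure)
  have g_ge: "0 \<le> 1 + g z" for z using g_le[of z] by linarith
  \<comment> \<open>Orthogonality concerns Bochner integrals, whereas the tests use nonnegative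
    ones; for nonnegative integrable d the two can be exchanged.\<close>
  have key: "(\<integral>\<^sup>+z. ennreal ((1 + g z) * d z) \<partial>Q) = (\<integral>\<^sup>+z. ennreal (d z) \<partial>Q)"
    if d: "d \<in> semistatic" and pos: "\<And>z. z \<in> space Q \<Longrightarrow> 0 \<le> d z" for d
  proof -
    have int: "integrable Q d" by (rule semistatic_integrable[OF d])
    have int': "integrable Q (\<lambda>z. d z * g z)"
      by (rule Bochner_Integration.integrable_bound[OF int])
         (use int g_le in \<open>auto simp: abs_mult intro!: AE_I2 mult_left_le\<close>)
    have "(\<integral>\<^sup>+z. ennreal ((1 + g z) * d z) \<partial>Q) = ennreal (\<integral>z. (1 + g z) * d z \<partial>Q)"
    proof (rule nn_integral_eq_integral)
      show "integrable Q (\<lambda>z. (1 + g z) * d z)"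
        using int int' by (simp add: algebra_simps)
      show "AE z in Q. 0 \<le> (1 + g z) * d z"
        using pos g_ge by (intro AE_I2 mult_nonneg_nonneg)
    qed
    also have "(\<integral>z. (1 + g z) * d z \<partial>Q) = (\<integral>z. d z \<partial>Q)"
      using int int' ortho[OF d] by (simp add: algebra_simps)
    also have "ennreal \<dots> = (\<integral>\<^sup>+z. ennreal (d z) \<partial>Q)"
      using int pos by (intro nn_integral_eq_integral[symmetric]) (auto intro!: AE_I2)
    finally show ?thesis .
  qed
  have mult: "ennreal (1 + g z) * ennreal c = ennreal ((1 + g z) * c)" for z c
    using g_ge by (simp add: ennreal_mult')
  show "(\<lambda>z. ennreal (1 + g z)) \<in> borel_measurable Q" by measurable
  show "(\<integral>\<^sup>+z. ennreal (1 + g z) * indicator A (fst z) \<partial>Q) = emeasure \<mu> A" if A: "A \<in> sets \<mu>" for A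
  proof -
    have "(\<integral>\<^sup>+z. ennreal (indicat_real A (fst z)) \<partial>Q) = (\<integral>\<^sup>+x. ennreal (indicat_real A x) \<partial>distr Q \<mu> fst)"
      using A by (subst nn_integral_distr) auto
    also have "\<dots> = emeasure \<mu> A" using A by (simp add: ennreal_indicator flip: \<mu>_eq)
    finally show ?thesis
      using key[OF indicator_fst_semistatic[OF A]] by (simp add: mult flip: ennreal_indicator)
  qed
  show "(\<integral>\<^sup>+z. ennreal (1 + g z) * indicator A (snd z) \<partial>Q) = emeasure \<nu> A" if A: "A \<in> sets \<nu>" for A
  proof -
    have "(\<integral>\<^sup>+z. ennreal (indicat_real A (snd z)) \<partial>Q) = (\<integral>\<^sup>+x. ennreal (indicat_real A x) \<partial>distr Q \<nu> snd)"
      using A by (subst nn_integral_distr) auto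
    also have "\<dots> = emeasure \<nu> A" using A by (simp add: ennreal_indicator flip: \<nu>_eq)
    finally show ?thesis
      using key[OF indicator_snd_semistatic[OF A]] by (simp add: mult flip: ennreal_indicator)
  qed
  show "(\<integral>\<^sup>+z. ennreal (1 + g z) * ennreal (snd z) * indicator A (fst z) \<partial>Q)
      = (\<integral>\<^sup>+x. ennreal x * indicator A x \<partial>\<mu>)" if A: "A \<in> sets \<mu>" for A
  proof -
    have "(\<integral>\<^sup>+z. ennreal (1 + g z) * ennreal (snd z) * indicator A (fst z) \<partial>Q)
        = (\<integral>\<^sup>+z. ennreal ((1 + g z) * (snd z * indicat_real A (fst z))) \<partial>Q)"
      by (intro nn_integral_cong) (auto simp: mult indicator_def)
    also have "\<dots> = (\<integral>\<^sup>+x. ennreal (x * indicat_real A x) \<partial>\<mu>)"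
      using key[OF snd_semistatic[OF A]] nn_integral_snd_indicator[OF A] by (auto simp: space_Q)
    also have "\<dots> = (\<integral>\<^sup>+x. ennreal x * indicator A x \<partial>\<mu>)"
      by (intro nn_integral_cong) (auto simp: indicator_def)
    finally show ?thesis .
  qed
qed

lemma extremal_imp_dense:
  assumes ext: "extremal_martingale_measure \<mu> \<nu> Q"
  shows "dense_in_L1 Q semistatic"
proof (rule ccontr)
  assume "\<not> dense_in_L1 Q semistatic"
  then obtain g f where g [measurable]: "g \<in> borel_measurable Q" and g_le: "\<And>z. \<bar>g z\<bar> \<le> 1"
    and ortho: "\<And>d. d \<in> semistatic \<Longrightarrow> (\<integral>z. d z * g z \<partial>Q) = 0"
    and f: "integrable Q f" "(\<integral>z. f z * g z \<partial>Q) \<noteq> 0"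
    using separating_function by blast
  have int_g: "integrable Q g"
    by (rule integrable_const_bound[of _ 1]) (use g_le in auto)
  \<comment> \<open>The sign \<open>s\<close> treats the weights 1 + g and 1 - g together.\<close>
  define N where "N s = density Q (\<lambda>z. ennreal (1 + s * g z))" for s :: real
  have N_measure: "measure (N s) A = measure Q A + s * (\<integral>z. indicat_real A z * g z \<partial>Q)"
    if s: "\<bar>s\<bar> = 1" and A: "A \<in> sets Q" for s A
  proof -
    have "\<bar>s * g z\<bar> \<le> 1" for z using g_le s by (simp add: abs_mult)
    then have pos: "0 \<le> 1 + s * g z" for z by (smt (verit))
    have int: "integrable Q (\<lambda>z. indicat_real A z)" "integrable Q (\<lambda>z. indicat_real A z * g z)"
      using integrable_mult_indicator[OF A int_g] A by (auto simp: less_top[symmetric])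
    then have int': "integrable Q (\<lambda>z. indicat_real A z + s * (indicat_real A z * g z))"
      by simp
    have "emeasure (N s) A = (\<integral>\<^sup>+z. ennreal (1 + s * g z) * indicator A z \<partial>Q)"
      unfolding N_def by (rule emeasure_density[OF _ A]) measurable
    also have "\<dots> = (\<integral>\<^sup>+z. ennreal (indicat_real A z + s * (indicat_real A z * g z)) \<partial>Q)"
      by (intro nn_integral_cong) (auto simp: indicator_def)
    also have "\<dots> = ennreal (\<integral>z. indicat_real A z + s * (indicat_real A z * g z) \<partial>Q)"
      using pos by (intro nn_integral_eq_integral[OF int']) (auto simp: indicator_def)
    also have "(\<integral>z. indicat_real A z + s * (indicat_real A z * g z) \<partial>Q)
        = measure Q A + s * (\<integral>z. indicat_real A z * g z \<partial>Q)"
      using int A by simp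
    finally have "emeasure (N s) A = ennreal \<dots>" .
    moreover have "0 \<le> (\<integral>z. indicat_real A z + s * (indicat_real A z * g z) \<partial>Q)"
      using pos by (intro Bochner_Integration.integral_nonneg) (auto simp: indicator_def)
    ultimately show ?thesis
      using int A by (simp add: measure_def enn2real_ennreal)
  qed
  have "N s \<in> martingale_measures \<mu> \<nu>" if s: "\<bar>s\<bar> = 1" for s
    unfolding N_def
  proof (rule perturbation)
    fix d assume d: "d \<in> semistatic"
    have "(\<integral>z. d z * (s * g z) \<partial>Q) = s * (\<integral>z. d z * g z \<partial>Q)"
      by (subst integral_mult_right_zero[symmetric]) (simp add: ac_simps)
    with ortho[OF d] show "(\<integral>z. d z * (s * g z) \<partial>Q) = 0" by simp
  qed (use g_le s in \<open>auto simp: abs_mult\<close>)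
  then have "N 1 \<in> martingale_measures \<mu> \<nu>" "N (-1) \<in> martingale_measures \<mu> \<nu>" by auto
  moreover have "\<forall>A\<in>sets quadrant. measure Q A = 1/2 * measure (N 1) A + (1 - 1/2) * measure (N (-1)) A"
    by (simp add: N_measure sets_Q field_simps)
  ultimately have "Q = N 1"
    using ext unfolding extremal_martingale_measure_def
    by (elim conjE allE[of _ "1/2"] allE[of _ "N 1"] allE[of _ "N (-1)"]) auto
  \<comment> \<open>By \<open>N_measure\<close>, Q = N 1 forces the integral of g over every set to
    be 0, hence g = 0 almost surely. The function f, whose pairing with g is nonzero, excludes
    this.\<close>
  then have "(\<integral>z. indicat_real A z * g z \<partial>Q) = 0" if "A \<in> sets Q" for A
    using N_measure[of 1 A] that by simp
  then have "AE z in Q. g z = 0"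
    by (intro density_zero[OF int_g]) (simp add: set_lebesgue_integral_def)
  then have "AE z in Q. f z * g z = 0" by eventually_elim simp
  then have "(\<integral>z. f z * g z \<partial>Q) = 0" by (rule integral_eq_zero_AE)
  with f(2) show False by contradiction
qed

end

theorem theorem3p3:
  fixes \<mu> \<nu> :: "real measure" and Q :: "(real \<times> real) measure"
  assumes "prob_space \<mu>" and "sets \<mu> = sets half_line"
    and "prob_space \<nu>" and "sets \<nu> = sets half_line"
    and "has_bochner_integral \<mu> (\<lambda>x. x) 1"
    and "has_bochner_integral \<nu> (\<lambda>y. y) 1"
    and "convex_order \<mu> \<nu>"
    and "Q \<in> martingale_measures \<mu> \<nu>"
  shows "extremal_martingale_measure \<mu> \<nu> Q \<longleftrightarrow>
    dense_in_L1 Q (semistatic_functions \<mu> \<nu> Q)"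
proof -
  interpret martingale_measure \<mu> \<nu> Q
    using assms by unfold_locales (auto simp: has_bochner_integral_iff)
  show ?thesis using extremal_imp_dense dense_imp_extremal by blast
qed

end
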